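(* For every $0<\alpha<0.5$ and all sufficiently large $n$, there exists a binary $k$-batch code $[N,n,k]^B$ with redundancy $r=N-n$ such that $$k=\Theta\big((n/\log n)^{0.5-\alpha}\big),\qquad r=\mathcal{O}\big(n^{1-\frac{\alpha}{3}}(\log n)^{\frac{\alpha}{3}}\big).$$ In particular, for $0<\epsilon<0.5$: $r_B\big(n,k=\Omega(n^{\epsilon^-})\big)=\mathcal{O}\big(n^{\delta(\epsilon)^+}\big)$ where $\delta(\epsilon)=\frac56+\frac{\epsilon}{3}$, and $r_B\big(n,k=\Theta(n^\epsilon)\big)=o(n)$. For $\epsilon\ge0.5$, there exists a binary $k$-batch code $[N,n,k]^B$ of dimension $n$ with $k=\Theta(n^\epsilon)$ and $N=\mathcal{O}(n^{0.5+\epsilon^+})$.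
   Context: A binary $[N,n,k]^B$ code ($k$-batch code) is a binary linear code of length $N$ encoding $n$ information bits $x_1,\dots,x_n$ such that for every multiset $\{i_1,\dots,i_k\}$ of indices there exist $k$ mutually disjoint sets $R_1,\dots,R_k\subseteq\{1,\dots,N\}$ such that, for each $j$, $x_{i_j}$ is a function of the codeword bits indexed by $R_j$. Its redundancy is $N-n$; $r_B(n,k)$ is the minimum redundancy of a binary $[N,n,k]^B$ code. Notation: $f(n)=\Omega(n^{a^-})$ means $f(n)=\Omega(n^{a-\tau})$ for all $\tau>0$; $f(n)=\mathcal{O}(n^{a^+})$ means $f(n)=\mathcal{O}(n^{a+\tau})$ for all $\tau>0$; $r_B(n,k=\Omega(n^{\epsilon^-}))=\mathcal{O}(n^{\delta^+})$ means there exist binary $k$-batch codes of dimension $n$ with $k=\Omega(n^{\epsilon^-})$ and redundancy $\mathcal{O}(n^{\delta^+})$. Logarithms are to base 2. *)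

theory Defs
  imports Complex_Main "HOL-Library.Landau_Symbols"
begin

text \<open>A binary linear code of length N with n information bits x_0..x_{n-1}
  is given by its generator matrix, described column-wise: codeword bit t
  (t < N) is the GF(2)-sum of the information bits indexed by S t,
  where S t is a subset of {..<n}.\<close>

definition lin_code :: "nat \<Rightarrow> nat \<Rightarrow> (nat \<Rightarrow> nat set) \<Rightarrow> bool" where
  "lin_code n N S \<longleftrightarrow> (\<forall>t<N. S t \<subseteq> {..<n})"

definition enc :: "(nat \<Rightarrow> nat set) \<Rightarrow> (nat \<Rightarrow> bool) \<Rightarrow> nat \<Rightarrow> bool" where
  "enc S x t = odd (card {i \<in> S t. x i})"

definition recovers :: "(nat \<Rightarrow> nat set) \<Rightarrow> nat set \<Rightarrow> nat \<Rightarrow> bool" where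
  "recovers S R i \<longleftrightarrow>
     (\<exists>g :: (nat \<Rightarrow> bool) \<Rightarrow> bool. \<forall>x. x i = g (\<lambda>t. if t \<in> R then enc S x t else False))"

definition batch_code :: "nat \<Rightarrow> nat \<Rightarrow> nat \<Rightarrow> (nat \<Rightarrow> nat set) \<Rightarrow> bool" where
  "batch_code N n k S \<longleftrightarrow> lin_code n N S \<and>
     (\<forall>is. length is = k \<and> set is \<subseteq> {..<n} \<longrightarrow>
        (\<exists>R :: nat \<Rightarrow> nat set.
           (\<forall>j<k. R j \<subseteq> {..<N}) \<and>
           (\<forall>j<k. \<forall>j'<k. j \<noteq> j' \<longrightarrow> R j \<inter> R j' = {}) \<and>
           (\<forall>j<k. recovers S (R j) (is ! j))))"

definition has_batch_code :: "nat \<Rightarrow> nat \<Rightarrow> nat \<Rightarrow> bool" where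
  "has_batch_code N n k \<longleftrightarrow> (\<exists>S. batch_code N n k S)"

end

theory Submission
  imports Defs "HOL-Library.Disjoint_Sets" "HOL-Library.Function_Algebras" "HOL-Library.Z2"
    "HOL-Algebra.Algebraic_Closure_Type" "HOL-Real_Asymp.Real_Asymp"
begin

text \<open>
  For \<open>\<alpha> < 1/3\<close> the codes are multiplicity codes in four variables over the field \<open>K\<close> with
  \<open>q = 2 ^ l\<close> elements: a polynomial \<open>f\<close> is stored through its derivatives of order below \<open>s + 4\<close> at
  all points of \<open>K^4\<close>, and the information symbols are directional derivatives of order below \<open>s\<close>, each
  split into \<open>l\<close> bits. Along a line the degree of \<open>f\<close> is less than \<open>(s + 4) (q - 1)\<close>, so the
  \<open>q - 1\<close> points of a line other than \<open>p\<close> determine \<open>f\<close> on it, and \<open>s\<close> lines through \<open>p\<close> in a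
  plane containing the direction \<open>v\<close> determine the derivatives at \<open>p\<close> along \<open>v\<close>. Lines through \<open>p\<close>
  are disjoint off \<open>p\<close>, hence fewer than \<open>q\<^sup>2 (q - s)\<close> used points leave a plane with \<open>s\<close> untouched
  lines; since a recovering set has at most \<open>s (q - 1)\<close> points, \<open>k \<approx> q\<^sup>2 / (2 s)\<close> queries can be
  served greedily. The redundancy is a fraction \<open>O(1 / s)\<close> of the length \<open>\<approx> (s q)^4 log q\<close>.

  For \<open>\<alpha> \<ge> 1/3\<close> it suffices to add to \<open>n\<close> points of \<open>K^3\<close> the parities over the lines with \<open>k\<close>
  directions on the conic \<open>(1, x, x\<^sup>2)\<close>: such a line meets at most one of the lines through a given
  point, so \<open>k\<close> queries can be served greedily with redundancy \<open>k * q\<^sup>2\<close>. For \<open>\<epsilon> \<ge> 1/2\<close> a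
  multiplicity code with \<open>s = 1\<close> is repeated.
\<close>

section \<open>Serving batches of queries\<close>

definition batch_servable :: "nat \<Rightarrow> 't set \<Rightarrow> 'q set \<Rightarrow> ('t set \<Rightarrow> 'q \<Rightarrow> bool) \<Rightarrow> bool" where
  "batch_servable k T Q serves \<longleftrightarrow>
     (\<forall>qs. length qs = k \<and> set qs \<subseteq> Q \<longrightarrow>
        (\<exists>R. (\<forall>j<k. R j \<subseteq> T \<and> serves (R j) (qs ! j)) \<and> disjoint_family_on R {..<k}))"

lemma batch_servableI:
  assumes "\<And>qs. length qs = k \<Longrightarrow> set qs \<subseteq> Q \<Longrightarrow>
    \<exists>R. (\<forall>j<k. R j \<subseteq> T \<and> serves (R j) (qs ! j)) \<and> disjoint_family_on R {..<k}"
  shows "batch_servable k T Q serves"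
  unfolding batch_servable_def using assms by simp

lemma batch_servableD:
  assumes "batch_servable k T Q serves" "length qs = k" "set qs \<subseteq> Q"
  shows "\<exists>R. (\<forall>j<k. R j \<subseteq> T \<and> serves (R j) (qs ! j)) \<and> disjoint_family_on R {..<k}"
  using assms by (simp add: batch_servable_def)

lemma batch_servable_vimage:
  assumes "batch_servable k T Q serves" and g: "g ` Q' \<subseteq> Q"
    and "\<And>R q. R \<subseteq> T \<Longrightarrow> q \<in> Q' \<Longrightarrow> serves R (g q) \<Longrightarrow> serves' (T' \<inter> e -` R) q"
  shows "batch_servable k T' Q' serves'"
proof (rule batch_servableI)
  fix qs assume qs: "length qs = k" "set qs \<subseteq> Q'"
  then have "length (map g qs) = k" "set (map g qs) \<subseteq> Q"
    using g by auto
  from batch_servableD[OF assms(1) this] obtain R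
    where "\<forall>j<k. R j \<subseteq> T \<and> serves (R j) (map g qs ! j)" and R_disj: "disjoint_family_on R {..<k}"
    by (elim exE conjE) (rule that)
  then have R: "R j \<subseteq> T" "serves (R j) (map g qs ! j)" if "j < k" for j
    using that by auto
  have "serves' (T' \<inter> e -` R j) (qs ! j)" if "j < k" for j
    using R(1,2)[OF that] qs that by (intro assms(3)) auto
  moreover have "disjoint_family_on (\<lambda>j. T' \<inter> e -` R j) {..<k}"
    using R_disj by (auto simp: disjoint_family_on_def)
  ultimately show "\<exists>R. (\<forall>j<k. R j \<subseteq> T' \<and> serves' (R j) (qs ! j)) \<and> disjoint_family_on R {..<k}"
    by (intro exI[of _ "\<lambda>j. T' \<inter> e -` R j"]) simp
qed

lemma disjoint_family_on_append:
  fixes k k' :: nat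
  assumes disj: "disjoint_family_on R {..<k}" "disjoint_family_on R' {..<k'}" "T \<inter> T' = {}"
    and sub: "\<And>j. j < k \<Longrightarrow> R j \<subseteq> T" "\<And>j. j < k' \<Longrightarrow> R' j \<subseteq> T'"
  shows "disjoint_family_on (\<lambda>j. if j < k then R j else R' (j - k)) {..<k + k'}"
  unfolding disjoint_family_on_def
proof (intro ballI impI)
  fix i j assume ij: "i \<in> {..<k + k'}" "j \<in> {..<k + k'}" "i \<noteq> j"
  have shift: "j - k < k'" if "j < k + k'" "k \<le> j" for j
    using that by linarith
  consider "i < k" "j < k" | "i < k" "k \<le> j" | "k \<le> i" "j < k" | "k \<le> i" "k \<le> j"
    by linarith
  then show "(if i < k then R i else R' (i - k)) \<inter> (if j < k then R j else R' (j - k)) = {}"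
  proof cases
    case 1
    then show ?thesis
      using disjoint_family_onD[OF disj(1), of i j] ij(3) by simp
  next
    case 2
    then show ?thesis
      using sub(1)[of i] sub(2)[OF shift[of j]] ij disj(3) by auto
  next
    case 3
    then show ?thesis
      using sub(1)[of j] sub(2)[OF shift[of i]] ij disj(3) by auto
  next
    case 4
    then show ?thesis
      using disjoint_family_onD[OF disj(2), of "i - k" "j - k"] shift[of i] shift[of j] ij by auto
  qed
qed

lemma batch_servable_add:
  assumes "batch_servable k T Q serves" "batch_servable k' T' Q serves" and disj: "T \<inter> T' = {}"
  shows "batch_servable (k + k') (T \<union> T') Q serves"
proof (rule batch_servableI)
  fix qs assume qs: "length qs = k + k'" "set qs \<subseteq> Q"
  have "length (take k qs) = k" "set (take k qs) \<subseteq> Q"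
    using qs by (auto dest: in_set_takeD)
  from batch_servableD[OF assms(1) this] obtain R
    where R: "\<forall>j<k. R j \<subseteq> T \<and> serves (R j) (take k qs ! j)" and R_disj: "disjoint_family_on R {..<k}"
    by (elim exE conjE) (rule that)
  have "length (drop k qs) = k'" "set (drop k qs) \<subseteq> Q"
    using qs by (auto dest: in_set_dropD)
  from batch_servableD[OF assms(2) this] obtain R'
    where R': "\<forall>j<k'. R' j \<subseteq> T' \<and> serves (R' j) (drop k qs ! j)" and R'_disj: "disjoint_family_on R' {..<k'}"
    by (elim exE conjE) (rule that)
  let ?R = "\<lambda>j. if j < k then R j else R' (j - k)"
  have "?R j \<subseteq> T \<union> T' \<and> serves (?R j) (qs ! j)" if "j < k + k'" for j
  proof (cases "j < k")
    case True
    then show ?thesis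
      using R by auto
  next
    case False
    then have "j - k < k'"
      using that by linarith
    then show ?thesis
      using R' False qs(1) by auto
  qed
  moreover have "disjoint_family_on ?R {..<k + k'}"
    using R R' by (intro disjoint_family_on_append[OF R_disj R'_disj disj]) auto
  ultimately show "\<exists>R. (\<forall>j<k + k'. R j \<subseteq> T \<union> T' \<and> serves (R j) (qs ! j)) \<and> disjoint_family_on R {..<k + k'}"
    by (intro exI[of _ ?R]) simp
qed

lemma batch_servable_mono:
  assumes "batch_servable k T Q serves" "k' \<le> k"
  shows "batch_servable k' T Q serves"
proof (rule batch_servableI)
  fix qs assume qs: "length qs = k'" "set qs \<subseteq> Q"
  show "\<exists>R. (\<forall>j<k'. R j \<subseteq> T \<and> serves (R j) (qs ! j)) \<and> disjoint_family_on R {..<k'}"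
  proof (cases "qs = []")
    case True
    then show ?thesis using qs by (simp add: disjoint_family_on_def)
  next
    case False
    let ?qs = "qs @ replicate (k - k') (hd qs)"
    have "length ?qs = k" "set ?qs \<subseteq> Q"
      using qs assms(2) hd_in_set[OF False] by auto
    from batch_servableD[OF assms(1) this] obtain R
      where "\<forall>j<k. R j \<subseteq> T \<and> serves (R j) (?qs ! j)" and R_disj: "disjoint_family_on R {..<k}"
      by (elim exE conjE) (rule that)
    then have R: "R j \<subseteq> T" "serves (R j) (?qs ! j)" if "j < k" for j
      using that by auto
    have "R j \<subseteq> T \<and> serves (R j) (qs ! j)" if "j < k'" for j
      using R(1,2)[of j] that assms(2) qs by (simp add: nth_append)
    moreover have "disjoint_family_on R {..<k'}"
      by (rule disjoint_family_on_mono[OF _ R_disj]) (use assms(2) in auto)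
    ultimately show ?thesis by (intro exI[of _ R]) simp
  qed
qed

lemma batch_servable_greedy:
  assumes step: "\<And>q \<R>. q \<in> Q \<Longrightarrow> finite \<R> \<Longrightarrow> card \<R> < k \<Longrightarrow>
      (\<And>R. R \<in> \<R> \<Longrightarrow> R \<subseteq> T \<and> (\<exists>q'\<in>Q. serves R q')) \<Longrightarrow> \<exists>R\<subseteq>T. serves R q \<and> R \<inter> \<Union>\<R> = {}"
  shows "batch_servable k T Q serves"
proof (rule batch_servableI)
  fix qs assume qs: "length qs = k" "set qs \<subseteq> Q"
  have "\<exists>R. (\<forall>j<i. R j \<subseteq> T \<and> serves (R j) (qs ! j)) \<and> disjoint_family_on R {..<i}" if "i \<le> k" for i
    using that
  proof (induction i)
    case 0
    show ?case by (simp add: disjoint_family_on_def)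
  next
    case (Suc i)
    then obtain R where R: "\<forall>j<i. R j \<subseteq> T \<and> serves (R j) (qs ! j)" "disjoint_family_on R {..<i}"
      by auto
    have query: "qs ! j \<in> Q" if "j \<le> i" for j
      using qs Suc.prems that by (auto intro: subsetD[OF qs(2)])
    have "card (R ` {..<i}) < k"
      using card_image_le[of "{..<i}" R] Suc.prems by simp
    then have "\<exists>R'\<subseteq>T. serves R' (qs ! i) \<and> R' \<inter> \<Union>(R ` {..<i}) = {}"
      using query R(1) by (intro step) auto
    then obtain R' where R': "R' \<subseteq> T" "serves R' (qs ! i)" "R' \<inter> \<Union>(R ` {..<i}) = {}"
      by blast
    have "\<forall>j<Suc i. (R(i := R')) j \<subseteq> T \<and> serves ((R(i := R')) j) (qs ! j)"
      using R(1) R'(1,2) by (auto simp: less_Suc_eq)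
    moreover have "disjoint_family_on (R(i := R')) {..<Suc i}"
      unfolding disjoint_family_on_def
    proof (intro ballI impI)
      fix j j' assume "j \<in> {..<Suc i}" "j' \<in> {..<Suc i}" "j \<noteq> j'"
      then consider "j < i" "j' < i" | "j < i" "j' = i" | "j = i" "j' < i"
        by (auto simp: less_Suc_eq)
      then show "(R(i := R')) j \<inter> (R(i := R')) j' = {}"
        using R'(3) disjoint_family_onD[OF R(2), of j j'] \<open>j \<noteq> j'\<close> by cases auto
    qed
    ultimately show ?case by (intro exI[of _ "R(i := R')"] conjI)
  qed
  then show "\<exists>R. (\<forall>j<k. R j \<subseteq> T \<and> serves (R j) (qs ! j)) \<and> disjoint_family_on R {..<k}"
    by blast
qed

lemma batch_code_iff:
  "batch_code N n k S \<longleftrightarrow> lin_code n N S \<and> batch_servable k {..<N} {..<n} (recovers S)"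
  by (simp only: batch_code_def batch_servable_def disjoint_family_on_def Ball_def lessThan_iff
      imp_conjR all_conj_distrib conj_ac)

lemma recovers_iff:
  "recovers S R i \<longleftrightarrow> (\<forall>x y. (\<forall>t\<in>R. enc S x t = enc S y t) \<longrightarrow> x i = y i)"
proof
  assume "recovers S R i"
  then obtain g where g: "\<And>x. x i = g (\<lambda>t. if t \<in> R then enc S x t else False)"
    unfolding recovers_def by blast
  show "\<forall>x y. (\<forall>t\<in>R. enc S x t = enc S y t) \<longrightarrow> x i = y i"
  proof (intro allI impI)
    fix x y assume "\<forall>t\<in>R. enc S x t = enc S y t"
    then have "(\<lambda>t. if t \<in> R then enc S x t else False) = (\<lambda>t. if t \<in> R then enc S y t else False)"
      by auto
    then show "x i = y i"
      using g[of x] g[of y] by simp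
  qed
next
  assume inj: "\<forall>x y. (\<forall>t\<in>R. enc S x t = enc S y t) \<longrightarrow> x i = y i"
  let ?received = "\<lambda>x t. if t \<in> R then enc S x t else False"
  have "x i = (\<exists>y. ?received y = ?received x \<and> y i)" for x
    using inj by (metis (mono_tags, lifting))
  then show "recovers S R i"
    unfolding recovers_def by (intro exI[of _ "\<lambda>z. \<exists>y. ?received y = z \<and> y i"]) blast
qed

lemma recovers_reindex:
  assumes "recovers S R i" "\<And>t. t \<in> R \<Longrightarrow> \<exists>t'\<in>R'. S' t' = S t"
  shows "recovers S' R' i"
  unfolding recovers_iff
proof (intro allI impI)
  fix x y assume eq: "\<forall>t\<in>R'. enc S' x t = enc S' y t"
  have "enc S x t = enc S y t" if "t \<in> R" for t
    using assms(2)[OF that] eq by (force simp: enc_def)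
  then show "x i = y i"
    using assms(1) by (simp add: recovers_iff)
qed

lemma has_batch_code_mono:
  "has_batch_code N n k \<Longrightarrow> k' \<le> k \<Longrightarrow> has_batch_code N n k'"
  by (auto simp: has_batch_code_def batch_code_iff intro: batch_servable_mono)

lemma has_batch_code_shorten:
  assumes "has_batch_code N n k" "n' \<le> n"
  shows "has_batch_code N n' k"
proof -
  obtain S where S: "lin_code n N S" "batch_servable k {..<N} {..<n} (recovers S)"
    using assms(1) by (auto simp: has_batch_code_def batch_code_iff)
  define S' where "S' t = S t \<inter> {..<n'}" for t
  have enc: "enc S' x t = enc S (\<lambda>i. i < n' \<and> x i) t" for x t
    unfolding enc_def S'_def by (rule arg_cong[where f = "\<lambda>A. odd (card A)"]) auto
  have "recovers S' R i" if "recovers S R i" "i < n'" for R i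
    unfolding recovers_iff
  proof (intro allI impI)
    fix x y assume "\<forall>t\<in>R. enc S' x t = enc S' y t"
    then have "(i < n' \<and> x i) = (i < n' \<and> y i)"
      using that(1) unfolding recovers_iff enc by blast
    then show "x i = y i"
      using that(2) by simp
  qed
  then have "batch_servable k {..<N} {..<n'} (recovers S')"
    by (intro batch_servable_vimage[OF S(2), where g = "\<lambda>i. i" and e = "\<lambda>t. t"])
       (use assms(2) in \<open>auto simp: inf.absorb2\<close>)
  moreover have "lin_code n' N S'"
    by (auto simp: lin_code_def S'_def)
  ultimately show ?thesis
    by (auto simp: has_batch_code_def batch_code_iff)
qed

lemma has_batch_code_add:
  assumes "has_batch_code N n k" "has_batch_code N' n k'"
  shows "has_batch_code (N + N') n (k + k')"
proof -
  obtain S where S: "lin_code n N S" "batch_servable k {..<N} {..<n} (recovers S)"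
    using assms(1) by (auto simp: has_batch_code_def batch_code_iff)
  obtain S' where S': "lin_code n N' S'" "batch_servable k' {..<N'} {..<n} (recovers S')"
    using assms(2) by (auto simp: has_batch_code_def batch_code_iff)
  define S'' where "S'' t = (if t < N then S t else S' (t - N))" for t
  have "batch_servable k {..<N} {..<n} (recovers S'')"
  proof (rule batch_servable_vimage[OF S(2), where g = "\<lambda>i. i" and e = "\<lambda>t. t"])
    fix R i assume "R \<subseteq> {..<N}" "recovers S R i"
    then show "recovers S'' ({..<N} \<inter> (\<lambda>t. t) -` R) i"
      by (elim recovers_reindex) (auto simp: S''_def)
  qed simp
  moreover have "batch_servable k' {N..<N + N'} {..<n} (recovers S'')"
  proof (rule batch_servable_vimage[OF S'(2), where g = "\<lambda>i. i" and e = "\<lambda>t. t - N"])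
    fix R i assume R: "R \<subseteq> {..<N'}" and rec: "recovers S' R i"
    show "recovers S'' ({N..<N + N'} \<inter> (\<lambda>t. t - N) -` R) i"
    proof (rule recovers_reindex[OF rec])
      fix t assume "t \<in> R"
      then show "\<exists>t'\<in>{N..<N + N'} \<inter> (\<lambda>t. t - N) -` R. S'' t' = S' t"
        using R by (intro bexI[of _ "N + t"]) (auto simp: S''_def)
    qed
  qed simp
  ultimately have "batch_servable (k + k') ({..<N} \<union> {N..<N + N'}) {..<n} (recovers S'')"
    by (rule batch_servable_add) auto
  also have "{..<N} \<union> {N..<N + N'} = {..<N + N'}" by auto
  finally have "batch_servable (k + k') {..<N + N'} {..<n} (recovers S'')" .
  moreover have "lin_code n (N + N') S''"
    using S(1) S'(1) by (auto simp: lin_code_def S''_def)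
  ultimately show ?thesis
    by (auto simp: has_batch_code_def batch_code_iff)
qed

lemma has_batch_code_repeat:
  assumes "has_batch_code N n k"
  shows "has_batch_code (r * N) n (r * k)"
proof (induction r)
  case 0
  then show ?case
    by (auto simp: has_batch_code_def batch_code_def lin_code_def)
next
  case (Suc r)
  then show ?case
    using has_batch_code_add[OF assms] by simp
qed

section \<open>Batch codes from functionals on an elementary abelian 2-group\<close>

definition xor_group :: "'v::ab_group_add set \<Rightarrow> bool" where
  "xor_group V \<longleftrightarrow> finite V \<and> 0 \<in> V \<and> (\<forall>x\<in>V. \<forall>y\<in>V. x + y \<in> V) \<and> (\<forall>x\<in>V. x + x = 0)"

lemma xor_groupD:
  assumes "xor_group V"
  shows "finite V" "0 \<in> V" "x \<in> V \<Longrightarrow> y \<in> V \<Longrightarrow> x + y \<in> V" "x \<in> V \<Longrightarrow> x + x = 0"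
  using assms by (auto simp: xor_group_def)

lemma xor_group_cancel: "xor_group V \<Longrightarrow> x \<in> V \<Longrightarrow> x + (x + y) = y"
  by (simp add: xor_groupD(4) add.assoc[symmetric])

lemma xor_group_eq_iff: "xor_group V \<Longrightarrow> x \<in> V \<Longrightarrow> x + y = 0 \<longleftrightarrow> x = y"
  by (metis xor_group_cancel add.right_neutral xor_groupD(4))

lemma xor_group_sum:
  assumes "xor_group V" "\<And>a. a \<in> A \<Longrightarrow> d a \<in> V"
  shows "(\<Sum>a\<in>A. d a) \<in> V"
  using assms(2) by (induction A rule: infinite_finite_induct) (simp_all add: xor_groupD[OF assms(1)])

definition additive_on :: "'v::ab_group_add set \<Rightarrow> ('v \<Rightarrow> 'w::ab_group_add) \<Rightarrow> bool" where
  "additive_on V f \<longleftrightarrow> (\<forall>x\<in>V. \<forall>y\<in>V. f (x + y) = f x + f y)"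

lemma additive_onD: "additive_on V f \<Longrightarrow> x \<in> V \<Longrightarrow> y \<in> V \<Longrightarrow> f (x + y) = f x + f y"
  by (simp add: additive_on_def)

lemma additive_on_0: "xor_group V \<Longrightarrow> additive_on V f \<Longrightarrow> f 0 = 0"
  by (metis add.right_neutral add_cancel_right_right additive_onD xor_groupD(2))

lemma additive_on_comp: "additive_on V f \<Longrightarrow> f ` V \<subseteq> K \<Longrightarrow> additive_on K g \<Longrightarrow> additive_on V (g \<circ> f)"
  by (simp add: additive_on_def image_subset_iff)

lemma additive_on_sum:
  assumes V: "xor_group V" and f: "additive_on V f" and d: "\<And>a. a \<in> A \<Longrightarrow> d a \<in> V"
  shows "f (\<Sum>a\<in>A. d a) = (\<Sum>a\<in>A. f (d a))"
  using d
proof (induction A rule: infinite_finite_induct)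
  case (insert a A)
  then have "(\<Sum>a\<in>A. d a) \<in> V"
    by (intro xor_group_sum[OF V]) auto
  with insert show ?case
    by (simp add: additive_onD[OF f])
qed (simp_all add: additive_on_0[OF V f])

definition determines :: "'v set \<Rightarrow> ('v \<Rightarrow> 'w::zero) set \<Rightarrow> ('v \<Rightarrow> 'u::zero) \<Rightarrow> bool" where
  "determines V F g \<longleftrightarrow> (\<forall>x\<in>V. (\<forall>f\<in>F. f x = 0) \<longrightarrow> g x = 0)"

abbreviation separating :: "'v::zero set \<Rightarrow> ('v \<Rightarrow> 'w::zero) set \<Rightarrow> bool" where
  "separating V F \<equiv> determines V F (\<lambda>x. x)"

lemma xor_group_adjoin:
  assumes V: "xor_group V" and W: "xor_group W" "W \<subseteq> V" and y: "y \<in> V"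
  shows "xor_group (W \<union> (+) y ` W)"
  using W y xor_groupD[OF W(1)] xor_groupD[OF V] xor_group_cancel[OF V y]
  unfolding xor_group_def by (auto simp: algebra_simps)

text \<open>A subgroup that is maximal among those avoiding \<open>x\<close> has index 2.\<close>

lemma ex_hyperplane_avoiding:
  assumes V: "xor_group V" and x: "x \<in> V" "x \<noteq> 0"
  obtains W where "W \<subseteq> V" "xor_group W" "x \<notin> W" "\<And>y. y \<in> V \<Longrightarrow> y \<notin> W \<Longrightarrow> x + y \<in> W"
proof -
  let ?avoiding = "{W. W \<subseteq> V \<and> xor_group W \<and> x \<notin> W}"
  have "finite ?avoiding"
    by (rule finite_subset[of _ "Pow V"]) (use xor_groupD(1)[OF V] in auto)
  moreover have "{0} \<in> ?avoiding"
    using x xor_groupD(2)[OF V] by (simp add: xor_group_def)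
  ultimately obtain W where W: "W \<subseteq> V" "xor_group W" "x \<notin> W"
    and max: "\<forall>W'. W' \<subseteq> V \<and> xor_group W' \<and> x \<notin> W' \<longrightarrow> W \<subseteq> W' \<longrightarrow> W = W'"
    using finite_has_maximal2[of ?avoiding "{0}"] by auto
  have "x + y \<in> W" if y: "y \<in> V" "y \<notin> W" for y
  proof -
    let ?W' = "W \<union> (+) y ` W"
    have "?W' \<subseteq> V"
      using W(1) y(1) xor_groupD(3)[OF V] by auto
    moreover have "y \<in> ?W'"
      using xor_groupD(2)[OF W(2)] by force
    ultimately have "x \<in> ?W'"
      using max xor_group_adjoin[OF V W(2,1) y(1)] y(2) by (metis Un_upper1)
    then obtain w where w: "w \<in> W" "x = y + w"
      using W(3) by auto
    have "x + y = w"
      using xor_group_cancel[OF V y(1), of w] by (simp add: w(2) add.commute)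
    then show ?thesis
      using w(1) by simp
  qed
  with W show ?thesis
    by (rule that)
qed

lemma separating_functionals:
  assumes V: "xor_group V"
  shows "separating V {\<phi> :: _ \<Rightarrow> bit. additive_on V \<phi>}"
  unfolding determines_def
proof (intro ballI impI, rule ccontr)
  fix x assume x: "x \<in> V" "x \<noteq> 0" and zero: "\<forall>\<phi>\<in>{\<phi> :: _ \<Rightarrow> bit. additive_on V \<phi>}. \<phi> x = 0"
  obtain W where W: "W \<subseteq> V" "xor_group W" "x \<notin> W" and translate: "\<And>y. y \<in> V \<Longrightarrow> y \<notin> W \<Longrightarrow> x + y \<in> W"
    by (rule ex_hyperplane_avoiding[OF V x]) (rule that)
  have "(y + z \<notin> W) = ((y \<notin> W) \<noteq> (z \<notin> W))" if y: "y \<in> V" and z: "z \<in> V" for y z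
  proof (cases "y \<in> W \<or> z \<in> W")
    case True
    then show ?thesis
      using xor_groupD(3)[OF W(2)] xor_group_cancel[OF V y, of z] xor_group_cancel[OF V z, of y]
      by (metis add.commute)
  next
    case False
    then have "(x + y) + (x + z) \<in> W"
      using y z by (intro xor_groupD(3)[OF W(2)] translate) auto
    also have "(x + y) + (x + z) = x + (x + (y + z))"
      by (simp add: algebra_simps)
    also have "\<dots> = y + z"
      by (rule xor_group_cancel[OF V x(1)])
    finally show ?thesis
      using False by simp
  qed
  then have "additive_on V (\<lambda>y. of_bool (y \<notin> W) :: bit)"
    by (simp add: additive_on_def)
  then show False
    using zero W(3) by auto
qed

lemma ex_minimal_separating:
  assumes V: "finite V" and \<Lambda>: "separating V \<Lambda>"
  obtains B where "finite B" "B \<subseteq> \<Lambda>" "separating V B" "\<And>\<phi>. \<phi> \<in> B \<Longrightarrow> \<not> separating V (B - {\<phi>})"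
proof -
  let ?P = "\<lambda>B. finite B \<and> B \<subseteq> \<Lambda> \<and> separating V B"
  obtain c where c: "\<And>x. x \<in> V \<Longrightarrow> x \<noteq> 0 \<Longrightarrow> c x \<in> \<Lambda> \<and> c x x \<noteq> 0"
    using \<Lambda> unfolding determines_def by metis
  have "?P (c ` (V - {0}))"
    using c V unfolding determines_def by fastforce
  then obtain B where B: "?P B" and min: "\<And>B'. ?P B' \<Longrightarrow> card B \<le> card B'"
    using ex_has_least_nat[of ?P "c ` (V - {0})" card] by blast
  have "\<not> separating V (B - {\<phi>})" if "\<phi> \<in> B" for \<phi>
  proof
    assume "separating V (B - {\<phi>})"
    then have "card B \<le> card (B - {\<phi>})"
      using B by (intro min) auto
    then show False
      using card_Diff1_less[of B \<phi>] B that by simp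
  qed
  then show ?thesis
    using that B by blast
qed

definition dual_basis :: "'v::ab_group_add set \<Rightarrow> ('v \<Rightarrow> bit) set \<Rightarrow> (('v \<Rightarrow> bit) \<Rightarrow> 'v) \<Rightarrow> bool" where
  "dual_basis V B d \<longleftrightarrow> finite B \<and> separating V B \<and>
     (\<forall>\<phi>\<in>B. additive_on V \<phi> \<and> d \<phi> \<in> V \<and> (\<forall>\<psi>\<in>B. \<psi> (d \<phi>) = of_bool (\<psi> = \<phi>)))"

lemma ex_dual_basis:
  assumes V: "xor_group V" and \<Lambda>: "\<And>\<phi>. \<phi> \<in> \<Lambda> \<Longrightarrow> additive_on V \<phi>" "separating V \<Lambda>"
  obtains B d where "B \<subseteq> \<Lambda>" "dual_basis V B d"
proof -
  obtain B where B: "finite B" "B \<subseteq> \<Lambda>" "separating V B" "\<And>\<phi>. \<phi> \<in> B \<Longrightarrow> \<not> separating V (B - {\<phi>})"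
    by (rule ex_minimal_separating[OF xor_groupD(1)[OF V] \<Lambda>(2)]) (rule that)
  have "\<exists>x\<in>V. \<forall>\<psi>\<in>B. \<psi> x = of_bool (\<psi> = \<phi>)" if \<phi>: "\<phi> \<in> B" for \<phi>
  proof -
    obtain x where x: "x \<in> V" "x \<noteq> 0" "\<And>\<psi>. \<psi> \<in> B - {\<phi>} \<Longrightarrow> \<psi> x = 0"
      using B(4)[OF \<phi>] by (auto simp: determines_def)
    moreover have "\<phi> x = 1"
    proof (rule ccontr)
      assume "\<phi> x \<noteq> 1"
      then have "\<psi> x = 0" if "\<psi> \<in> B" for \<psi>
        using x(3)[of \<psi>] that by (cases "\<psi> = \<phi>") auto
      then show False
        using B(3) x(1,2) by (simp add: determines_def)
    qed
    ultimately show ?thesis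
      by (intro bexI[of _ x]) auto
  qed
  then obtain d where "\<And>\<phi>. \<phi> \<in> B \<Longrightarrow> d \<phi> \<in> V" "\<And>\<phi> \<psi>. \<phi> \<in> B \<Longrightarrow> \<psi> \<in> B \<Longrightarrow> \<psi> (d \<phi>) = of_bool (\<psi> = \<phi>)"
    by metis
  then have "dual_basis V B d"
    using B \<Lambda>(1) by (auto simp: dual_basis_def)
  then show ?thesis
    using that B(2) by blast
qed

lemma dual_basisD:
  assumes "dual_basis V B d"
  shows "finite B" "separating V B" "\<phi> \<in> B \<Longrightarrow> additive_on V \<phi>" "\<phi> \<in> B \<Longrightarrow> d \<phi> \<in> V"
    "\<phi> \<in> B \<Longrightarrow> \<psi> \<in> B \<Longrightarrow> \<psi> (d \<phi>) = of_bool (\<psi> = \<phi>)"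
  using assms by (auto simp: dual_basis_def)

lemma dual_basis_sum:
  assumes V: "xor_group V" and B: "dual_basis V B d" and Y: "Y \<subseteq> B" and \<psi>: "\<psi> \<in> B"
  shows "\<psi> (\<Sum>\<phi>\<in>Y. d \<phi>) = of_bool (\<psi> \<in> Y)"
proof -
  have "\<psi> (\<Sum>\<phi>\<in>Y. d \<phi>) = (\<Sum>\<phi>\<in>Y. \<psi> (d \<phi>))"
    using dual_basisD[OF B] Y \<psi> by (intro additive_on_sum[OF V]) auto
  also have "\<dots> = (\<Sum>\<phi>\<in>Y. if \<psi> = \<phi> then 1 else 0)"
    using dual_basisD(5)[OF B _ \<psi>] Y by (intro sum.cong) auto
  finally show ?thesis
    using finite_subset[OF Y dual_basisD(1)[OF B]] by (simp add: sum.delta)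
qed

lemma dual_basis_eqI:
  assumes V: "xor_group V" and B: "dual_basis V B d" and xy: "x \<in> V" "y \<in> V"
    and eq: "\<And>\<phi>. \<phi> \<in> B \<Longrightarrow> \<phi> x = \<phi> y"
  shows "x = y"
proof -
  have "\<phi> (x + y) = 0" if "\<phi> \<in> B" for \<phi>
    using additive_onD[OF dual_basisD(3)[OF B that] xy] eq[OF that] by simp
  then have "x + y = 0"
    using dual_basisD(2)[OF B] xor_groupD(3)[OF V xy] by (auto simp: determines_def)
  then show ?thesis
    using xor_group_eq_iff[OF V xy(1)] by simp
qed

lemma dual_basis_card:
  assumes V: "xor_group V" and B: "dual_basis V B d"
  shows "card V = 2 ^ card B"
proof -
  have "bij_betw (\<lambda>x. {\<phi> \<in> B. \<phi> x = 1}) V (Pow B)"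
  proof (rule bij_betwI')
    fix x y assume xy: "x \<in> V" "y \<in> V"
    show "({\<phi> \<in> B. \<phi> x = 1} = {\<phi> \<in> B. \<phi> y = 1}) = (x = y)"
    proof
      assume eq: "{\<phi> \<in> B. \<phi> x = 1} = {\<phi> \<in> B. \<phi> y = 1}"
      have "\<phi> x = \<phi> y" if "\<phi> \<in> B" for \<phi>
        using eq[THEN eqset_imp_iff, of \<phi>] that by (cases "\<phi> x"; cases "\<phi> y") auto
      then show "x = y"
        by (rule dual_basis_eqI[OF V B xy])
    qed simp
  next
    fix Y assume Y: "Y \<in> Pow B"
    then have "(\<Sum>\<phi>\<in>Y. d \<phi>) \<in> V"
      using dual_basisD(4)[OF B] by (intro xor_group_sum[OF V]) auto
    moreover have "Y = {\<psi> \<in> B. \<psi> (\<Sum>\<phi>\<in>Y. d \<phi>) = 1}"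
    proof (rule Set.set_eqI)
      fix \<psi> show "\<psi> \<in> Y \<longleftrightarrow> \<psi> \<in> {\<psi> \<in> B. \<psi> (\<Sum>\<phi>\<in>Y. d \<phi>) = 1}"
        using Y dual_basis_sum[OF V B, of Y \<psi>] by (cases "\<psi> \<in> B") auto
    qed
    ultimately show "\<exists>x\<in>V. Y = {\<phi> \<in> B. \<phi> x = 1}"
      by (rule bexI[rotated])
  qed auto
  then show ?thesis
    by (simp add: bij_betw_same_card card_Pow dual_basisD(1)[OF B])
qed

lemma sum_bit_eq_odd:
  assumes "finite A"
  shows "(\<Sum>i\<in>A. f i :: bit) = of_bool (odd (card {i \<in> A. f i = 1}))"
  using assms
proof (induction A)
  case (insert a A)
  have "{i \<in> insert a A. f i = 1} = (if f a = 1 then insert a {i \<in> A. f i = 1} else {i \<in> A. f i = 1})"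
    by auto
  then show ?case
    using insert by (cases "f a") simp_all
qed simp

lemma enc_eq_functional:
  fixes \<psi> :: "'v::ab_group_add \<Rightarrow> bit"
  assumes V: "xor_group V" and \<psi>: "additive_on V \<psi>" and v: "\<And>i. i < n \<Longrightarrow> v i \<in> V"
    and S: "S t = {i. i < n \<and> \<psi> (v i) = 1}"
  shows "of_bool (enc S x t) = \<psi> (\<Sum>i\<in>{i. i < n \<and> x i}. v i)"
proof -
  have "\<psi> (\<Sum>i\<in>{i. i < n \<and> x i}. v i) = (\<Sum>i\<in>{i. i < n \<and> x i}. \<psi> (v i))"
    using v by (intro additive_on_sum[OF V \<psi>]) auto
  also have "\<dots> = of_bool (odd (card {i \<in> {i. i < n \<and> x i}. \<psi> (v i) = 1}))"
    by (rule sum_bit_eq_odd) simp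
  also have "{i \<in> {i. i < n \<and> x i}. \<psi> (v i) = 1} = {i \<in> S t. x i}"
    by (auto simp: S)
  finally show ?thesis
    by (simp add: enc_def)
qed

lemma dual_basis_coordinate:
  assumes V: "xor_group V" and B: "dual_basis V B d" and b: "bij_betw b {..<n} B" and i: "i < n"
  shows "b i (\<Sum>i\<in>{i. i < n \<and> x i}. d (b i)) = of_bool (x i)"
proof -
  let ?I = "{i. i < n \<and> x i}"
  have inj: "inj_on b {..<n}"
    by (rule bij_betw_imp_inj_on[OF b])
  have "b i \<in> B" "b ` ?I \<subseteq> B"
    using bij_betwE[OF b] i by auto
  then have "b i (\<Sum>\<phi>\<in>b ` ?I. d \<phi>) = of_bool (b i \<in> b ` ?I)"
    using dual_basis_sum[OF V B] by simp
  moreover have "(\<Sum>\<phi>\<in>b ` ?I. d \<phi>) = (\<Sum>i\<in>?I. d (b i))"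
    by (subst sum.reindex) (auto intro: inj_on_subset[OF inj])
  moreover have "b i \<in> b ` ?I \<longleftrightarrow> x i"
    using inj_on_image_mem_iff[OF inj, of i ?I] i by auto
  ultimately show ?thesis
    by simp
qed

lemma recovers_of_determines:
  fixes \<Phi> :: "'t \<Rightarrow> 'v::ab_group_add \<Rightarrow> bit" and \<beta> :: "'v \<Rightarrow> bit"
  assumes V: "xor_group V" and msg: "\<And>x. msg x \<in> V"
    and enc: "\<And>x t. t < N \<Longrightarrow> of_bool (enc S x t) = \<Phi> (e t) (msg x)"
    and R: "R \<subseteq> e ` {..<N}" "\<And>t. t \<in> R \<Longrightarrow> additive_on V (\<Phi> t)"
    and \<beta>: "additive_on V \<beta>" "\<And>x. \<beta> (msg x) = of_bool (x i)" and det: "determines V (\<Phi> ` R) \<beta>"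
  shows "recovers S ({..<N} \<inter> e -` R) i"
  unfolding recovers_iff
proof (intro allI impI)
  fix x y assume eq: "\<forall>t\<in>{..<N} \<inter> e -` R. enc S x t = enc S y t"
  have "\<Phi> t (msg x + msg y) = 0" if t: "t \<in> R" for t
  proof -
    obtain t' where t': "t' < N" "e t' = t"
      using R(1) t by auto
    then have "\<Phi> t (msg x) = \<Phi> t (msg y)"
      using eq t enc[OF t'(1), of x] enc[OF t'(1), of y] by simp
    then show ?thesis
      using additive_onD[OF R(2)[OF t] msg msg] by simp
  qed
  then have "\<beta> (msg x + msg y) = 0"
    using det xor_groupD(3)[OF V msg msg] unfolding determines_def by blast
  then have "\<beta> (msg x) + \<beta> (msg y) = 0"
    using additive_onD[OF \<beta>(1) msg msg] by simp
  then show "x i = y i"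
    by (simp add: \<beta>(2) split: if_splits)
qed

text \<open>The information bits form a basis chosen from \<open>\<Psi> ` Q\<close>, so every request for one of them is a query in \<open>Q\<close>.\<close>

theorem batch_code_from_functionals:
  fixes V :: "'v::ab_group_add set" and \<Psi> :: "'q \<Rightarrow> 'v \<Rightarrow> bit" and \<Phi> :: "'t \<Rightarrow> 'v \<Rightarrow> bit"
  assumes V: "xor_group V" "card V = 2 ^ n"
    and Q: "\<And>p. p \<in> Q \<Longrightarrow> additive_on V (\<Psi> p)" "separating V (\<Psi> ` Q)"
    and T: "finite T" "\<And>t. t \<in> T \<Longrightarrow> additive_on V (\<Phi> t)"
    and serv: "batch_servable k T Q (\<lambda>R p. determines V (\<Phi> ` R) (\<Psi> p))"
  shows "has_batch_code (card T) n k"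
proof -
  obtain B d where B: "B \<subseteq> \<Psi> ` Q" "dual_basis V B d"
    by (rule ex_dual_basis[OF V(1) _ Q(2)]) (use Q(1) in auto)
  have "card B = n"
    using dual_basis_card[OF V(1) B(2)] V(2) by simp
  then obtain b where b: "bij_betw b {..<n} B"
    using ex_bij_betw_nat_finite[OF dual_basisD(1)[OF B(2)]] by (auto simp: atLeast0LessThan)
  obtain e where e: "bij_betw e {..<card T} T"
    using ex_bij_betw_nat_finite[OF T(1)] by (auto simp: atLeast0LessThan)
  have bB: "b i \<in> B" if "i < n" for i
    using bij_betwE[OF b] that by simp
  then have "\<forall>i<n. \<exists>p\<in>Q. b i = \<Psi> p"
    using B(1) by blast
  then obtain query where query: "\<And>i. i < n \<Longrightarrow> query i \<in> Q" "\<And>i. i < n \<Longrightarrow> b i = \<Psi> (query i)"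
    by metis
  define S where "S t = {i. i < n \<and> \<Phi> (e t) (d (b i)) = 1}" for t
  define msg where "msg x = (\<Sum>i\<in>{i. i < n \<and> x i}. d (b i))" for x
  have msg: "msg x \<in> V" for x
    unfolding msg_def using bB dual_basisD(4)[OF B(2)] by (intro xor_group_sum[OF V(1)]) auto
  have enc: "of_bool (enc S x t) = \<Phi> (e t) (msg x)" if "t < card T" for x t
    unfolding msg_def using bij_betwE[OF e] that bB dual_basisD(4)[OF B(2)]
    by (intro enc_eq_functional[OF V(1) T(2)]) (auto simp: S_def)
  have "batch_servable k {..<card T} {..<n} (recovers S)"
  proof (rule batch_servable_vimage[OF serv, where g = query and e = e])
    show "query ` {..<n} \<subseteq> Q"
      using query(1) by auto
    fix R i assume R: "R \<subseteq> T" and "i \<in> {..<n}" and det: "determines V (\<Phi> ` R) (\<Psi> (query i))"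
    then have i: "i < n"
      by simp
    show "recovers S ({..<card T} \<inter> e -` R) i"
    proof (rule recovers_of_determines[where msg = msg and \<Phi> = \<Phi>])
      show "R \<subseteq> e ` {..<card T}"
        using R bij_betw_imp_surj_on[OF e] by simp
      show "b i (msg x) = of_bool (x i)" for x
        unfolding msg_def by (rule dual_basis_coordinate[OF V(1) B(2) b i])
    qed (use V(1) msg enc T(2) R dual_basisD(3)[OF B(2) bB[OF i]] det query(2)[OF i] in auto)
  qed
  moreover have "lin_code n (card T) S"
    by (auto simp: lin_code_def S_def)
  ultimately show ?thesis
    by (auto simp: has_batch_code_def batch_code_iff)
qed

definition bitwise :: "('k \<Rightarrow> bit) set \<Rightarrow> ('v \<Rightarrow> 'k) set \<Rightarrow> ('v \<Rightarrow> bit) set" where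
  "bitwise B F = (\<lambda>(f, \<beta>). \<beta> \<circ> f) ` (F \<times> B)"

lemma determines_bitwise:
  assumes B: "separating K B" and F: "\<forall>f\<in>F. f ` V \<subseteq> K" and det: "determines V F g"
  shows "determines V (bitwise B F) g"
  unfolding determines_def
proof (intro ballI impI)
  fix x assume x: "x \<in> V" and zero: "\<forall>\<phi>\<in>bitwise B F. \<phi> x = 0"
  have "f x = 0" if f: "f \<in> F" for f
  proof -
    have "\<beta> (f x) = 0" if "\<beta> \<in> B" for \<beta>
    proof -
      have "\<beta> \<circ> f \<in> bitwise B F"
        using f that by (force simp: bitwise_def)
      from bspec[OF zero this] show ?thesis
        by simp
    qed
    then show ?thesis
      using B bspec[OF F f] x by (auto simp: determines_def)
  qed
  then show "g x = 0"
    using det x by (simp add: determines_def)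
qed

corollary batch_code_from_additive_maps:
  fixes V :: "'v::ab_group_add set" and K :: "'k::ab_group_add set"
    and \<Psi> :: "'q \<Rightarrow> 'v \<Rightarrow> 'k" and \<Phi> :: "'t \<Rightarrow> 'j \<Rightarrow> 'v \<Rightarrow> 'k"
  assumes V: "xor_group V" "card V = 2 ^ n" and K: "xor_group K" "card K = 2 ^ l"
    and Q: "\<And>p. p \<in> Q \<Longrightarrow> additive_on V (\<Psi> p)" "\<And>p. p \<in> Q \<Longrightarrow> \<Psi> p ` V \<subseteq> K" "separating V (\<Psi> ` Q)"
    and T: "finite T" "finite J" "\<And>t j. t \<in> T \<Longrightarrow> j \<in> J \<Longrightarrow> additive_on V (\<Phi> t j)"
      "\<And>t j. t \<in> T \<Longrightarrow> j \<in> J \<Longrightarrow> \<Phi> t j ` V \<subseteq> K"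
    and serv: "batch_servable k T Q (\<lambda>R p. determines V (case_prod \<Phi> ` (R \<times> J)) (\<Psi> p))"
  shows "has_batch_code (card T * (card J * l)) n k"
proof -
  obtain B d where B: "dual_basis K B d"
    by (rule ex_dual_basis[OF K(1) _ separating_functionals[OF K(1)]]) auto
  define \<Psi>' :: "'q \<times> ('k \<Rightarrow> bit) \<Rightarrow> 'v \<Rightarrow> bit" where "\<Psi>' = (\<lambda>(p, \<beta>). \<beta> \<circ> \<Psi> p)"
  define \<Phi>' :: "'t \<times> 'j \<times> ('k \<Rightarrow> bit) \<Rightarrow> 'v \<Rightarrow> bit" where "\<Phi>' = (\<lambda>(t, j, \<beta>). \<beta> \<circ> \<Phi> t j)"
  have "has_batch_code (card (T \<times> J \<times> B)) n k"
  proof (rule batch_code_from_functionals[OF V, where Q = "Q \<times> B" and \<Psi> = \<Psi>' and \<Phi> = \<Phi>'])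
    show "additive_on V (\<Psi>' z)" if "z \<in> Q \<times> B" for z
      using that by (auto simp: \<Psi>'_def intro: additive_on_comp[OF Q(1,2) dual_basisD(3)[OF B]])
    show "additive_on V (\<Phi>' z)" if "z \<in> T \<times> J \<times> B" for z
      using that by (auto simp: \<Phi>'_def intro: additive_on_comp[OF T(3,4) dual_basisD(3)[OF B]])
    have "\<Psi>' ` (Q \<times> B) = bitwise B (\<Psi> ` Q)"
      by (force simp: \<Psi>'_def bitwise_def)
    moreover have "\<forall>f\<in>\<Psi> ` Q. f ` V \<subseteq> K"
      using Q(2) by auto
    ultimately show "separating V (\<Psi>' ` (Q \<times> B))"
      using determines_bitwise[OF dual_basisD(2)[OF B] _ Q(3)] by simp
    show "finite (T \<times> J \<times> B)"
      using T(1,2) dual_basisD(1)[OF B] by simp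
    show "batch_servable k (T \<times> J \<times> B) (Q \<times> B) (\<lambda>R z. determines V (\<Phi>' ` R) (\<Psi>' z))"
    proof (rule batch_servable_vimage[OF serv, where g = fst and e = fst])
      fix R z assume R: "R \<subseteq> T" and z: "z \<in> Q \<times> B" and det: "determines V (case_prod \<Phi> ` (R \<times> J)) (\<Psi> (fst z))"
      have "\<Phi>' ` (T \<times> J \<times> B \<inter> fst -` R) = bitwise B (case_prod \<Phi> ` (R \<times> J))"
        using R by (force simp: \<Phi>'_def bitwise_def)
      moreover have "\<forall>f\<in>case_prod \<Phi> ` (R \<times> J). f ` V \<subseteq> K"
        using T(4) R by auto
      ultimately have "determines V (\<Phi>' ` (T \<times> J \<times> B \<inter> fst -` R)) (\<Psi> (fst z))"
        using determines_bitwise[OF dual_basisD(2)[OF B] _ det] by simp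
      then show "determines V (\<Phi>' ` (T \<times> J \<times> B \<inter> fst -` R)) (\<Psi>' z)"
        using additive_on_0[OF K(1) dual_basisD(3)[OF B]] z by (auto simp: determines_def \<Psi>'_def)
    qed auto
  qed
  moreover have "card B = l"
    using dual_basis_card[OF K(1) B] K(2) by simp
  ultimately show ?thesis
    by (simp add: card_cartesian_product)
qed

section \<open>Finite fields\<close>

locale finite_subfield =
  fixes K :: "'a::field set" and q :: nat
  assumes prime_CHAR: "prime CHAR('a)" and q_eq_CHAR_power: "\<exists>l. q = CHAR('a) ^ l"
    and K_eq: "K = {x. x ^ q = x}" and card_K: "card K = q"
begin

lemma frobenius_add: "(x + y :: 'a) ^ q = x ^ q + y ^ q"
  using q_eq_CHAR_power freshmans_dream'[OF prime_CHAR] by blast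

lemma frobenius_add_poly: "(p + r :: 'a poly) ^ q = p ^ q + r ^ q"
proof -
  have "prime CHAR('a poly)"
    using prime_CHAR by simp
  from freshmans_dream'[OF this] show ?thesis
    using q_eq_CHAR_power by auto
qed

lemma q_pos: "0 < q"
  using q_eq_CHAR_power prime_gt_0_nat[OF prime_CHAR] by auto

lemma finite_K: "finite K"
  using card_K q_pos by (intro card_ge_0_finite) simp

lemma K_0 [simp]: "0 \<in> K" and K_1 [simp]: "1 \<in> K"
  using q_pos by (simp_all add: K_eq)

lemma q_gt_1: "1 < q"
proof -
  have "card {0 :: 'a, 1} \<le> card K"
    by (rule card_mono[OF finite_K]) simp
  then show ?thesis
    by (simp add: card_K)
qed

lemma K_add: "x \<in> K \<Longrightarrow> y \<in> K \<Longrightarrow> x + y \<in> K"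
  by (simp add: K_eq frobenius_add)

lemma K_mult: "x \<in> K \<Longrightarrow> y \<in> K \<Longrightarrow> x * y \<in> K"
  by (simp add: K_eq power_mult_distrib)

lemma K_uminus: "x \<in> K \<Longrightarrow> - x \<in> K"
  using frobenius_add[of x "- x"] q_pos by (simp add: K_eq eq_neg_iff_add_eq_0 add.commute zero_power)

lemma K_diff: "x \<in> K \<Longrightarrow> y \<in> K \<Longrightarrow> x - y \<in> K"
  using K_add[of x "- y"] K_uminus[of y] by simp

lemma K_divide: "x \<in> K \<Longrightarrow> y \<in> K \<Longrightarrow> x / y \<in> K"
  by (simp add: K_eq power_divide)

lemma K_power: "x \<in> K \<Longrightarrow> x ^ n \<in> K"
  by (induction n) (auto intro: K_mult)

lemma K_sum: "(\<And>a. a \<in> A \<Longrightarrow> f a \<in> K) \<Longrightarrow> (\<Sum>a\<in>A. f a) \<in> K"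
  by (induction A rule: infinite_finite_induct) (auto intro: K_add)

lemma K_prod: "(\<And>a. a \<in> A \<Longrightarrow> f a \<in> K) \<Longrightarrow> (\<Prod>a\<in>A. f a) \<in> K"
  by (induction A rule: infinite_finite_induct) (auto intro: K_mult)

lemma card_K_nonzero: "card (K - {0}) = q - 1"
  by (simp add: card_K finite_K)

lemma xor_group_K:
  assumes "CHAR('a) = 2"
  shows "xor_group K"
proof -
  have "x + x = 0" for x :: 'a
    using of_nat_CHAR[where 'a = 'a] assms by (simp add: mult_2[symmetric])
  then show ?thesis
    by (simp add: xor_group_def finite_K K_add)
qed

end

lemma card_roots_eq_degree:
  fixes p :: "'a::alg_closed_field poly"
  assumes p: "p \<noteq> 0" and simple: "\<And>x. poly p x = 0 \<Longrightarrow> poly (pderiv p) x \<noteq> 0"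
  shows "card {x. poly p x = 0} = degree p"
proof -
  obtain A where A: "size A = degree p" "p = smult (lead_coeff p) (\<Prod>x\<in>#A. [:-x, 1:])"
    using alg_closed_imp_factorization[OF p] by blast
  have poly_p: "poly p x = lead_coeff p * (\<Prod>y\<in>#A. x - y)" for x
    by (subst A(2)) (simp add: poly_prod_mset)
  have roots: "{x. poly p x = 0} = set_mset A"
    using p by (auto simp: poly_p prod_mset_zero_iff)
  have "count A x = 1" if x: "x \<in># A" for x
  proof -
    obtain A' where A': "A = add_mset x A'"
      using mset_add[OF x] by blast
    define r where "r = smult (lead_coeff p) (\<Prod>y\<in>#A'. [:-y, 1:])"
    have p_eq: "p = [:-x, 1:] * r"
      unfolding r_def by (subst A(2)) (simp add: A')
    have "poly (pderiv p) x = poly r x"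
      by (subst p_eq, subst pderiv_mult) (simp add: pderiv_pCons)
    then have "poly r x \<noteq> 0"
      using simple[of x] x roots by auto
    then have "x \<notin># A'"
      by (auto simp: r_def poly_prod_mset prod_mset_zero_iff)
    then show ?thesis
      by (simp add: A' not_in_iff)
  qed
  then have "card (set_mset A) = size A"
    by (simp add: size_multiset_overloaded_eq)
  then show ?thesis
    by (simp add: roots A(1))
qed

lemma finite_subfield_frobenius_fixed:
  assumes prime: "prime CHAR('a::alg_closed_field)" and l: "l > 0"
  defines "q \<equiv> CHAR('a) ^ l"
  shows "finite_subfield {x::'a. x ^ q = x} q"
proof -
  define p :: "'a poly" where "p = monom 1 q - monom 1 1"
  have q: "q > 1"
    unfolding q_def using prime_gt_1_nat[OF prime] l by (rule one_less_power)
  have deg: "degree p = q"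
    unfolding p_def diff_conv_add_uminus using q by (subst degree_add_eq_left) (auto simp: degree_monom_eq)
  have "of_nat q = (0::'a)"
    unfolding of_nat_eq_0_iff_char_dvd using l by (simp add: q_def dvd_power)
  then have "pderiv p = - 1"
    by (simp add: p_def pderiv_diff pderiv_monom one_pCons monom_0)
  then have "card {x. poly p x = 0} = degree p"
    using deg q by (intro card_roots_eq_degree) auto
  then have "card {x::'a. x ^ q = x} = q"
    by (simp add: deg) (simp add: p_def poly_monom)
  then show ?thesis
    using prime by unfold_locales (auto simp: q_def)
qed

lemma CHAR_bit: "CHAR(bit) = 2"
proof (rule CHAR_eqI)
  fix n assume n: "of_nat n = (0 :: bit)"
  show "2 dvd n"
  proof (rule ccontr)
    assume "\<not> 2 dvd n"
    then obtain k where "n = 2 * k + 1" by (elim oddE)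
    then have "of_nat n = (2 * of_nat k + 1 :: bit)" by simp
    also have "\<dots> = 1" by (simp only: bit_2_eq_0 mult_zero_left add_0)
    finally show False using n by simp
  qed
qed simp

lemma ex_binary_field:
  assumes "l > 0"
  obtains K :: "bit alg_closure set" where "finite_subfield K (2 ^ l)"
  using finite_subfield_frobenius_fixed[where 'a = "bit alg_closure", OF _ assms] that
  by (simp add: CHAR_bit)

section \<open>Multi-exponents\<close>

definition exponents :: "nat \<Rightarrow> nat \<Rightarrow> (nat \<Rightarrow> nat) set" where
  "exponents m a = {t \<in> extensional {..<m}. (\<Sum>j<m. t j) = a}"

definition simplex :: "nat \<Rightarrow> nat \<Rightarrow> (nat \<Rightarrow> nat) set" where
  "simplex m s = {t \<in> extensional {..<m}. (\<Sum>j<m. t j) < s}"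

lemma exponents_subset_simplex: "a < s \<Longrightarrow> exponents m a \<subseteq> simplex m s"
  by (auto simp: exponents_def simplex_def)

lemma exponents_component_le: "t \<in> exponents m a \<Longrightarrow> j < m \<Longrightarrow> t j \<le> a"
  using member_le_sum[of j "{..<m}" t] by (simp add: exponents_def)

lemma simplex_subset_PiE: "simplex m s \<subseteq> {..<m} \<rightarrow>\<^sub>E {..<s}"
proof
  fix t assume t: "t \<in> simplex m s"
  have "t j < s" if "j < m" for j
    using member_le_sum[of j "{..<m}" t] t that by (simp add: simplex_def)
  then show "t \<in> {..<m} \<rightarrow>\<^sub>E {..<s}"
    using t by (auto simp: simplex_def PiE_def)
qed

lemma finite_simplex: "finite (simplex m s)"
  by (rule finite_subset[OF simplex_subset_PiE]) (auto intro: finite_PiE)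

lemma finite_exponents: "finite (exponents m a)"
  by (rule finite_subset[OF exponents_subset_simplex finite_simplex]) (rule lessI)

lemma simplex_Suc: "simplex m (Suc s) = simplex m s \<union> exponents m s"
  by (auto simp: simplex_def exponents_def)

lemma simplex_mono: "s \<le> s' \<Longrightarrow> simplex m s \<subseteq> simplex m s'"
  by (auto simp: simplex_def)

lemma sum_exponents_Suc:
  "(\<Sum>t\<in>exponents (Suc m) a. f t) = (\<Sum>i\<le>a. \<Sum>t\<in>exponents m i. f (t(m := a - i)))"
proof -
  have "(\<Sum>i\<le>a. \<Sum>t\<in>exponents m i. f (t(m := a - i))) =
      (\<Sum>(i, t)\<in>(SIGMA i:{..a}. exponents m i). f (t(m := a - i)))"
    by (rule sum.Sigma) (auto simp: finite_exponents)
  also have "\<dots> = (\<Sum>t\<in>exponents (Suc m) a. f t)"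
    by (rule sum.reindex_bij_witness[where j = "\<lambda>(i, t). t(m := a - i)" and
          i = "\<lambda>t. (\<Sum>j<m. t j, restrict t {..<m})"])
       (auto simp: exponents_def extensional_def restrict_def fun_eq_iff)
  finally show ?thesis ..
qed

lemma coeff_prod_lessThan:
  "coeff (\<Prod>j<m. P j) a = (\<Sum>t\<in>exponents m a. \<Prod>j<m. coeff (P j) (t j))"
proof (induction m arbitrary: a)
  case 0
  have "exponents 0 a = (if a = 0 then {\<lambda>_. undefined} else {})"
    by (auto simp: exponents_def)
  then show ?case
    by simp
next
  case (Suc m)
  have "coeff (\<Prod>j<Suc m. P j) a = (\<Sum>i\<le>a. coeff (\<Prod>j<m. P j) i * coeff (P m) (a - i))"
    by (simp add: coeff_mult)
  also have "\<dots> = (\<Sum>t\<in>exponents (Suc m) a. \<Prod>j<Suc m. coeff (P j) (t j))"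
    by (simp add: Suc sum_exponents_Suc sum_distrib_right)
  finally show ?case .
qed

lemma card_exponents_le: "card (exponents (Suc m) a) \<le> Suc a ^ m"
proof -
  have "card (exponents (Suc m) a) \<le> card ({..<m} \<rightarrow>\<^sub>E {..<Suc a})"
  proof (rule card_inj_on_le[where f = "\<lambda>t. restrict t {..<m}"])
    show "(\<lambda>t. restrict t {..<m}) ` exponents (Suc m) a \<subseteq> {..<m} \<rightarrow>\<^sub>E {..<Suc a}"
      by (auto simp: less_Suc_eq_le exponents_component_le split: if_splits)
    show "inj_on (\<lambda>t. restrict t {..<m}) (exponents (Suc m) a)"
    proof (rule inj_onI)
      fix t u assume t: "t \<in> exponents (Suc m) a" and u: "u \<in> exponents (Suc m) a"
        and eq: "restrict t {..<m} = restrict u {..<m}"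
      have low: "t j = u j" if "j < m" for j
        using fun_cong[OF eq, of j] that by simp
      have "(\<Sum>j<m. t j) = (\<Sum>j<m. u j)"
        by (intro sum.cong) (auto simp: low)
      then have "t m = u m"
        using t u by (simp add: exponents_def)
      then show "t = u"
        using t u low by (intro extensionalityI[of _ "{..<Suc m}"]) (auto simp: exponents_def less_Suc_eq)
    qed
  qed (auto intro: finite_PiE)
  then show ?thesis
    by (simp add: card_PiE)
qed

lemma card_simplex_add_le: "card (simplex (Suc m) (s + d)) \<le> card (simplex (Suc m) s) + d * (s + d) ^ m"
proof (induction d)
  case (Suc d)
  have "card (simplex (Suc m) (s + Suc d)) \<le>
      card (simplex (Suc m) (s + d)) + card (exponents (Suc m) (s + d))"
    by (simp add: simplex_Suc card_Un_le)
  also have "\<dots> \<le> card (simplex (Suc m) s) + d * (s + d) ^ m + (s + Suc d) ^ m"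
    using Suc card_exponents_le[of m "s + d"] by (intro add_mono) simp_all
  also have "d * (s + d) ^ m \<le> d * (s + Suc d) ^ m"
    by (intro mult_left_mono power_mono) auto
  finally show ?case
    by (simp add: algebra_simps)
qed simp

lemma power_le_card_simplex:
  assumes "0 < m"
  shows "s ^ m \<le> m ^ m * card (simplex m s)"
proof (cases "s = 0")
  case True
  then show ?thesis
    using assms by (simp add: zero_power)
next
  case False
  define b where "b = Suc ((s - 1) div m)"
  have "m * (b - 1) \<le> s - 1"
    by (simp add: b_def)
  then have b_le: "m * (b - 1) < s"
    using False by linarith
  have "s - 1 < m * b"
    using assms dividend_less_times_div[of m "s - 1"] by (simp add: b_def)
  then have "s ^ m \<le> (m * b) ^ m"
    by (intro power_mono) auto
  also have "\<dots> = m ^ m * card ({..<m} \<rightarrow>\<^sub>E {..<b})"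
    by (simp add: power_mult_distrib card_PiE)
  also have "card ({..<m} \<rightarrow>\<^sub>E {..<b}) \<le> card (simplex m s)"
  proof (rule card_mono[OF finite_simplex], rule subsetI)
    fix t assume t: "t \<in> {..<m} \<rightarrow>\<^sub>E {..<b}"
    have "t j \<le> b - 1" if "j < m" for j
      using PiE_mem[OF t, of j] that by simp
    then have "(\<Sum>j<m. t j) \<le> (\<Sum>j<m. b - 1)"
      by (intro sum_mono) simp
    then show "t \<in> simplex m s"
      using b_le t by (simp add: simplex_def PiE_def)
  qed
  finally show ?thesis
    by simp
qed

lemma card_simplex_pos: "0 < m \<Longrightarrow> 0 < s \<Longrightarrow> 0 < card (simplex m s)"
  using power_le_card_simplex[of m s] by (cases "card (simplex m s) = 0") auto

section \<open>Restrictions of polynomials to lines\<close>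

text \<open>For \<open>f = (\<Sum>x\<in>I. c x * (\<Prod>j<m. H x j (X\<^sub>j)))\<close>, \<open>line_restr\<close> is the univariate polynomial \<open>f (p + T w)\<close>
  and \<open>hasse_deriv\<close> is the Hasse derivative of \<open>f\<close> of multi-order \<open>t\<close> at \<open>y\<close>.\<close>

definition line_restr ::
    "nat \<Rightarrow> 'x set \<Rightarrow> ('x \<Rightarrow> nat \<Rightarrow> 'a::field poly) \<Rightarrow> ('x \<Rightarrow> 'a) \<Rightarrow> (nat \<Rightarrow> 'a) \<Rightarrow> (nat \<Rightarrow> 'a) \<Rightarrow> 'a poly" where
  "line_restr m I H c p w = (\<Sum>x\<in>I. smult (c x) (\<Prod>j<m. pcompose (H x j) [:p j, w j:]))"

definition hasse_deriv ::
    "nat \<Rightarrow> 'x set \<Rightarrow> ('x \<Rightarrow> nat \<Rightarrow> 'a::field poly) \<Rightarrow> ('x \<Rightarrow> 'a) \<Rightarrow> (nat \<Rightarrow> 'a) \<Rightarrow> (nat \<Rightarrow> nat) \<Rightarrow> 'a" where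
  "hasse_deriv m I H c y t = (\<Sum>x\<in>I. c x * (\<Prod>j<m. coeff (pcompose (H x j) [:y j, 1:]) (t j)))"

lemma hasse_deriv_cong: "(\<And>j. j < m \<Longrightarrow> y j = y' j) \<Longrightarrow> hasse_deriv m I H c y t = hasse_deriv m I H c y' t"
  unfolding hasse_deriv_def by (intro sum.cong refl arg_cong2[where f = times] prod.cong) auto

lemma hasse_deriv_add: "hasse_deriv m I H (c + d) y t = hasse_deriv m I H c y t + hasse_deriv m I H d y t"
  by (simp add: hasse_deriv_def algebra_simps sum.distrib)

lemma line_restr_add: "line_restr m I H (c + d) p w = line_restr m I H c p w + line_restr m I H d p w"
  by (simp add: line_restr_def smult_add_left sum.distrib)

lemma line_restr_shift:
  "pcompose (line_restr m I H c p w) [:\<tau>, 1:] = line_restr m I H c (\<lambda>j. p j + \<tau> * w j) w"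
proof -
  have "pcompose [:p j, w j:] [:\<tau>, 1:] = [:p j + \<tau> * w j, w j:]" for j
    by (simp add: pcompose_pCons mult.commute)
  then show ?thesis
    by (simp add: line_restr_def pcompose_sum pcompose_smult pcompose_prod pcompose_assoc[symmetric])
qed

lemma coeff_pcompose_affine:
  fixes h :: "'a::field poly"
  shows "coeff (pcompose h [:b, d:]) n = coeff (pcompose h [:b, 1:]) n * d ^ n"
proof -
  have "pcompose h [:b, d:] = pcompose (pcompose h [:b, 1:]) [:0, d:]"
    by (simp add: pcompose_assoc[symmetric] pcompose_pCons)
  then show ?thesis
    by (simp add: coeff_pcompose_linear mult.commute)
qed

lemma coeff_line_restr:
  "coeff (line_restr m I H c y w) a = (\<Sum>t\<in>exponents m a. hasse_deriv m I H c y t * (\<Prod>j<m. w j ^ t j))"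
proof -
  have "coeff (line_restr m I H c y w) a = (\<Sum>x\<in>I. \<Sum>t\<in>exponents m a.
      c x * (\<Prod>j<m. coeff (pcompose (H x j) [:y j, 1:]) (t j)) * (\<Prod>j<m. w j ^ t j))"
    by (simp add: line_restr_def coeff_sum coeff_prod_lessThan coeff_pcompose_affine[of _ "y _" "w _"]
        prod.distrib sum_distrib_left mult.assoc)
  also have "\<dots> = (\<Sum>t\<in>exponents m a. hasse_deriv m I H c y t * (\<Prod>j<m. w j ^ t j))"
    by (subst sum.swap) (simp add: hasse_deriv_def sum_distrib_right)
  finally show ?thesis .
qed

lemma monom_dvd_line_restr:
  assumes "\<And>t. t \<in> simplex m s \<Longrightarrow> hasse_deriv m I H c y t = 0"
  shows "monom 1 s dvd line_restr m I H c y w"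
  unfolding monom_1_dvd_iff' coeff_line_restr
  using subsetD[OF exponents_subset_simplex] by (auto simp: assms intro!: sum.neutral)

lemma pcompose_power: "pcompose (p ^ n) r = pcompose p r ^ n" for p :: "'a::comm_semiring_1 poly"
  by (induction n) (simp_all add: pcompose_mult pcompose_1)

lemma pcompose_monom_1: "pcompose (monom 1 n) r = r ^ n" for r :: "'a::comm_semiring_1 poly"
  by (simp add: monom_altdef pcompose_power pcompose_pCons)

lemma power_dvd_of_monom_dvd_shift:
  fixes F :: "'a::field poly"
  assumes "monom 1 s dvd pcompose F [:\<tau>, 1:]"
  shows "[:-\<tau>, 1:] ^ s dvd F"
proof -
  obtain r where "pcompose F [:\<tau>, 1:] = [:0, 1:] ^ s * r"
    using assms by (auto simp: monom_altdef elim: dvdE)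
  then have "pcompose (pcompose F [:\<tau>, 1:]) [:-\<tau>, 1:] = [:-\<tau>, 1:] ^ s * pcompose r [:-\<tau>, 1:]"
    by (simp add: pcompose_mult pcompose_power pcompose_pCons)
  moreover have "pcompose (pcompose F [:\<tau>, 1:]) [:-\<tau>, 1:] = F"
    by (simp add: pcompose_assoc[symmetric] pcompose_pCons)
  ultimately show ?thesis
    by simp
qed

lemma poly_eq_0_of_high_order_roots:
  fixes F :: "'a::field poly"
  assumes A: "finite A" and dvd: "\<And>\<tau>. \<tau> \<in> A \<Longrightarrow> [:-\<tau>, 1:] ^ s dvd F" and deg: "degree F < s * card A"
  shows "F = 0"
proof (rule ccontr)
  assume F: "F \<noteq> 0"
  have s: "0 < s"
    using deg by (cases s) auto
  have ord: "s \<le> Polynomial.order \<tau> F" if "\<tau> \<in> A" for \<tau>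
    using dvd[OF that] F by (simp add: order_divides)
  then have roots: "A \<subseteq> {x. poly F x = 0}"
    using s F by (force simp: order_root)
  have "s * card A = (\<Sum>\<tau>\<in>A. s)"
    by simp
  also have "\<dots> \<le> (\<Sum>\<tau>\<in>A. Polynomial.order \<tau> F)"
    by (rule sum_mono) (rule ord)
  also have "\<dots> \<le> (\<Sum>\<tau> | poly F \<tau> = 0. Polynomial.order \<tau> F)"
    by (rule sum_mono2) (use roots poly_roots_finite[OF F] in auto)
  also have "\<dots> \<le> degree F"
    by (rule sum_order_le_degree[OF F])
  finally show False
    using deg by simp
qed

lemma line_restr_eq_0:
  assumes A: "finite A"
    and zero: "\<And>\<tau> t. \<tau> \<in> A \<Longrightarrow> t \<in> simplex m s \<Longrightarrow> hasse_deriv m I H c (\<lambda>j. p j + \<tau> * w j) t = 0"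
    and deg: "degree (line_restr m I H c p w) < s * card A"
  shows "line_restr m I H c p w = 0"
  using A _ deg
proof (rule poly_eq_0_of_high_order_roots)
  fix \<tau> assume "\<tau> \<in> A"
  then show "[:-\<tau>, 1:] ^ s dvd line_restr m I H c p w"
    by (intro power_dvd_of_monom_dvd_shift) (simp only: line_restr_shift monom_dvd_line_restr zero)
qed

text \<open>The coefficient of \<open>f (p + T (v + \<mu> u))\<close> at \<open>T^a\<close> is a polynomial in \<open>\<mu>\<close> of degree at most \<open>a\<close>.\<close>

lemma coeff_line_restr_eq_0:
  assumes M: "finite M" "a < card M"
    and zero: "\<And>\<mu>. \<mu> \<in> M \<Longrightarrow> line_restr m I H c p (\<lambda>j. v j + \<mu> * u j) = 0"
  shows "coeff (line_restr m I H c p v) a = 0"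
proof -
  define r where "r = (\<Sum>t\<in>exponents m a. smult (hasse_deriv m I H c p t) (\<Prod>j<m. [:v j, u j:] ^ t j))"
  have r: "poly r \<mu> = coeff (line_restr m I H c p (\<lambda>j. v j + \<mu> * u j)) a" for \<mu>
    by (simp add: r_def poly_sum poly_prod coeff_line_restr)
  have "degree r \<le> a"
    unfolding r_def
  proof (rule degree_sum_le[OF finite_exponents])
    fix t assume t: "t \<in> exponents m a"
    have "degree (smult (hasse_deriv m I H c p t) (\<Prod>j<m. [:v j, u j:] ^ t j)) \<le>
        (\<Sum>j<m. degree ([:v j, u j:] ^ t j))"
      by (rule order.trans[OF degree_smult_le degree_prod_sum_le[unfolded o_def]]) simp
    also have "\<dots> \<le> (\<Sum>j<m. t j)"
      by (intro sum_mono order.trans[OF degree_power_le]) simp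
    finally show "degree (smult (hasse_deriv m I H c p t) (\<Prod>j<m. [:v j, u j:] ^ t j)) \<le> a"
      using t by (simp add: exponents_def)
  qed
  then have "r = 0"
    using M zero by (intro poly_eqI_degree[of M]) (auto simp: r)
  then show ?thesis
    using r[of 0] by simp
qed

section \<open>Polynomial functions on a box\<close>

lemma sum_PiE_insert:
  assumes "finite A" "x \<notin> A" "\<And>j. j \<in> insert x A \<Longrightarrow> finite (B j)"
  shows "(\<Sum>e\<in>Pi\<^sub>E (insert x A) B. f e) = (\<Sum>n\<in>B x. \<Sum>e\<in>Pi\<^sub>E A B. f (e(x := n)))"
proof -
  have "(\<Sum>e\<in>Pi\<^sub>E (insert x A) B. f e) = (\<Sum>(n, e)\<in>B x \<times> Pi\<^sub>E A B. f (e(x := n)))"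
    unfolding PiE_insert_eq
    by (subst sum.reindex[OF inj_combinator[OF assms(2)]]) (simp add: case_prod_unfold)
  then show ?thesis
    by (simp add: sum.cartesian_product)
qed

lemma sum_box_insert_eq_poly:
  fixes a :: "('i \<Rightarrow> nat) \<Rightarrow> 'a::comm_semiring_1"
  assumes "finite A" "x \<notin> A"
  shows "(\<Sum>e\<in>(\<Pi>\<^sub>E j\<in>insert x A. {..<d j}). a e * (\<Prod>j\<in>insert x A. (p(x := y)) j ^ e j)) =
    poly (\<Sum>n<d x. monom (\<Sum>e\<in>(\<Pi>\<^sub>E j\<in>A. {..<d j}). a (e(x := n)) * (\<Prod>j\<in>A. p j ^ e j)) n) y"
proof -
  have "(\<Sum>e\<in>(\<Pi>\<^sub>E j\<in>insert x A. {..<d j}). a e * (\<Prod>j\<in>insert x A. (p(x := y)) j ^ e j)) =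
      (\<Sum>n<d x. \<Sum>e\<in>(\<Pi>\<^sub>E j\<in>A. {..<d j}). a (e(x := n)) * (\<Prod>j\<in>insert x A. (p(x := y)) j ^ (e(x := n)) j))"
    by (rule sum_PiE_insert[OF assms]) simp
  also have "\<dots> = (\<Sum>n<d x. \<Sum>e\<in>(\<Pi>\<^sub>E j\<in>A. {..<d j}). a (e(x := n)) * (\<Prod>j\<in>A. p j ^ e j) * y ^ n)"
  proof (intro sum.cong refl)
    fix n e
    have "(\<Prod>j\<in>A. (p(x := y)) j ^ (e(x := n)) j) = (\<Prod>j\<in>A. p j ^ e j)"
      by (intro prod.cong) (use assms in auto)
    then show "a (e(x := n)) * (\<Prod>j\<in>insert x A. (p(x := y)) j ^ (e(x := n)) j) =
        a (e(x := n)) * (\<Prod>j\<in>A. p j ^ e j) * y ^ n"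
      using assms by (simp add: mult_ac)
  qed
  finally show ?thesis
    by (simp add: poly_sum poly_monom sum_distrib_right)
qed

lemma coeff_eq_0_of_vanishing_on_box:
  fixes S :: "'i \<Rightarrow> 'a::field set"
  assumes "finite A" "\<And>j. j \<in> A \<Longrightarrow> finite (S j) \<and> d j \<le> card (S j)"
    and "\<And>p. p \<in> Pi\<^sub>E A S \<Longrightarrow> (\<Sum>e\<in>(\<Pi>\<^sub>E j\<in>A. {..<d j}). a e * (\<Prod>j\<in>A. p j ^ e j)) = 0"
    and "e \<in> (\<Pi>\<^sub>E j\<in>A. {..<d j})"
  shows "a e = 0"
  using assms
proof (induction A arbitrary: a e rule: finite_induct)
  case empty
  then show ?case
    by (simp add: PiE_empty_domain)
next
  case (insert x A)
  let ?E = "\<Pi>\<^sub>E j\<in>A. {..<d j}"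
  obtain n e' where e: "e = e'(x := n)" "n < d x" "e' \<in> ?E"
    using insert.prems(3) by (auto simp: PiE_insert_eq)
  have "(\<Sum>e'\<in>?E. a (e'(x := n)) * (\<Prod>j\<in>A. p j ^ e' j)) = 0" if p: "p \<in> Pi\<^sub>E A S" for p
  proof -
    define b where "b n = (\<Sum>e'\<in>?E. a (e'(x := n)) * (\<Prod>j\<in>A. p j ^ e' j))" for n
    define P where "P = (\<Sum>n<d x. monom (b n) n)"
    have "poly P y = 0" if "y \<in> S x" for y
    proof -
      have "p(x := y) \<in> Pi\<^sub>E (insert x A) S"
        using p that by (auto simp: PiE_insert_eq)
      from insert.prems(2)[OF this] show ?thesis
        unfolding P_def b_def sum_box_insert_eq_poly[OF insert.hyps] .
    qed
    moreover have "degree P \<le> d x - 1"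
      unfolding P_def by (intro degree_sum_le) (auto intro!: order.trans[OF degree_monom_le])
    ultimately have "P = 0"
      using insert.prems(1)[of x] e(2) by (intro poly_eqI_degree[of "S x"]) auto
    then have "coeff P n = 0"
      by simp
    then show ?thesis
      using e(2) by (simp add: P_def coeff_sum coeff_monom b_def if_distrib sum.delta cong: if_cong)
  qed
  with insert.prems(1) e(3) show ?case
    unfolding e(1) by (intro insert.IH[of "\<lambda>e'. a (e'(x := n))"]) auto
qed

section \<open>Multiplicity codes\<close>

context finite_subfield
begin

definition K_polys :: "'a poly set" where
  "K_polys = {p. \<forall>i. coeff p i \<in> K}"

lemma K_polysD: "p \<in> K_polys \<Longrightarrow> coeff p i \<in> K"
  by (simp add: K_polys_def)

lemma K_polys_affine: "a \<in> K \<Longrightarrow> b \<in> K \<Longrightarrow> [:a, b:] \<in> K_polys"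
  by (auto simp: K_polys_def coeff_pCons split: nat.splits)

lemma K_polys_smult: "a \<in> K \<Longrightarrow> p \<in> K_polys \<Longrightarrow> smult a p \<in> K_polys"
  by (simp add: K_polys_def K_mult)

lemma K_polys_mult: "p \<in> K_polys \<Longrightarrow> r \<in> K_polys \<Longrightarrow> p * r \<in> K_polys"
  unfolding K_polys_def by (auto intro!: coeff_mult_semiring_closed K_add K_mult)

lemma K_polys_power: "p \<in> K_polys \<Longrightarrow> p ^ n \<in> K_polys"
  by (induction n) (auto simp: K_polys_mult, simp add: K_polys_def coeff_1)

lemma K_polys_prod: "(\<And>j. j \<in> A \<Longrightarrow> f j \<in> K_polys) \<Longrightarrow> (\<Prod>j\<in>A. f j) \<in> K_polys"
  by (induction A rule: infinite_finite_induct) (auto simp: K_polys_mult, simp_all add: K_polys_def coeff_1)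

lemma K_polys_sum: "(\<And>j. j \<in> A \<Longrightarrow> f j \<in> K_polys) \<Longrightarrow> (\<Sum>j\<in>A. f j) \<in> K_polys"
  by (simp add: K_polys_def coeff_sum K_sum)

definition vanish_poly :: "'a poly" where
  "vanish_poly = monom 1 q - monom 1 1"

lemma vanish_poly_K: "vanish_poly \<in> K_polys"
  by (auto simp: K_polys_def vanish_poly_def coeff_monom intro: K_diff K_uminus)

lemma degree_vanish_poly_le: "degree vanish_poly \<le> q"
  unfolding vanish_poly_def using q_gt_1
  by (intro degree_diff_le order.trans[OF degree_monom_le]) auto

lemma pcompose_vanish_poly:
  assumes "p \<in> K" "w \<in> K"
  shows "pcompose vanish_poly [:p, w:] = smult w vanish_poly"
proof -
  have affine: "[:p, w:] = [:p:] + monom w 1"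
    by (simp add: monom_altdef)
  then have "[:p, w:] ^ q = [:p:] ^ q + monom w 1 ^ q"
    by (simp only: frobenius_add_poly)
  also have "\<dots> = [:p:] + monom w q"
    using assms by (simp add: K_eq monom_power poly_const_pow)
  finally have "pcompose vanish_poly [:p, w:] = monom w q - monom w 1"
    unfolding vanish_poly_def pcompose_diff pcompose_monom_1 by (simp add: affine)
  then show ?thesis
    by (simp add: vanish_poly_def smult_diff_right smult_monom)
qed

lemma coeff_vanish_poly_power_mult:
  assumes "t \<le> n"
  shows "coeff (vanish_poly ^ n * r) t = (if t = n then (- 1) ^ n * coeff r 0 else 0)"
proof -
  have "vanish_poly = monom 1 1 * (monom 1 (q - 1) - 1)"
    using q_gt_1 by (simp add: vanish_poly_def algebra_simps mult_monom)
  then have factor: "vanish_poly ^ n * r = monom 1 n * ((monom 1 (q - 1) - 1) ^ n * r)"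
    by (simp add: power_mult_distrib monom_power mult.assoc)
  have "coeff ((monom 1 (q - 1) - 1) ^ n * r) 0 = (- 1) ^ n * coeff r 0"
    using q_gt_1 by (simp add: coeff_mult coeff_0_power coeff_monom)
  then show ?thesis
    unfolding factor using assms by (cases "t = n") (auto simp: coeff_monom_mult)
qed

lemma homogeneous_vanishing:
  assumes t: "t < q - 1" and i: "i \<in> exponents m t"
    and zero: "\<And>w. w \<in> {..<m} \<rightarrow>\<^sub>E K \<Longrightarrow> w 0 = 1 \<Longrightarrow> (\<Sum>i\<in>exponents m t. a i * (\<Prod>j<m. w j ^ i j)) = 0"
    and m: "0 < m"
  shows "a i = 0"
proof -
  define b where "b i = (if i \<in> exponents m t then a i else 0)" for i
  define S where "S j = (if j = 0 then K - {0} else K)" for j :: nat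
  have box: "exponents m t \<subseteq> {..<m} \<rightarrow>\<^sub>E {..<Suc t}"
    using exponents_subset_simplex[OF lessI] simplex_subset_PiE by blast
  have "b i = 0"
  proof (rule coeff_eq_0_of_vanishing_on_box[where A = "{..<m}" and S = S and d = "\<lambda>_. Suc t"
        and a = b and e = i])
    fix w assume w: "w \<in> Pi\<^sub>E {..<m} S"
    have w0: "w 0 \<in> K" "w 0 \<noteq> 0" and wK: "\<And>j. j < m \<Longrightarrow> w j \<in> K"
      using w m by (auto simp: S_def PiE_def Pi_def split: if_splits)
    define v where "v = restrict (\<lambda>j. w j / w 0) {..<m}"
    have v: "v \<in> {..<m} \<rightarrow>\<^sub>E K" "v 0 = 1"
      using w0 wK m by (auto simp: v_def intro: K_divide)
    have scale: "(\<Prod>j<m. w j ^ i j) = w 0 ^ t * (\<Prod>j<m. v j ^ i j)" if "i \<in> exponents m t" for i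
    proof -
      have "(\<Prod>j<m. w j ^ i j) = (\<Prod>j<m. w 0 ^ i j * v j ^ i j)"
        by (intro prod.cong) (use w0 in \<open>auto simp: v_def power_mult_distrib[symmetric]\<close>)
      then show ?thesis
        using that by (simp add: prod.distrib power_sum[symmetric] exponents_def)
    qed
    have "(\<Sum>i\<in>{..<m} \<rightarrow>\<^sub>E {..<Suc t}. b i * (\<Prod>j<m. w j ^ i j)) = (\<Sum>i\<in>exponents m t. a i * (\<Prod>j<m. w j ^ i j))"
      by (rule sum.mono_neutral_cong_right) (use box in \<open>auto simp: b_def intro!: finite_PiE\<close>)
    also have "\<dots> = w 0 ^ t * (\<Sum>i\<in>exponents m t. a i * (\<Prod>j<m. v j ^ i j))"
      unfolding sum_distrib_left by (intro sum.cong refl) (simp add: scale mult_ac)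
    finally show "(\<Sum>i\<in>{..<m} \<rightarrow>\<^sub>E {..<Suc t}. b i * (\<Prod>j<m. w j ^ i j)) = 0"
      using zero[OF v] by simp
  next
    show "finite (S j) \<and> Suc t \<le> card (S j)" for j
      using t by (auto simp: S_def finite_K card_K)
  qed (use i box in auto)
  then show ?thesis
    using i by (simp add: b_def)
qed

end

locale multiplicity_code = finite_subfield K q for K :: "'a::field set" and q +
  fixes m s :: nat
  assumes m_ge_2: "2 \<le> m" and s_pos: "0 < s" and s_less_q: "s < q"
begin

text \<open>Polynomials are expanded in base \<open>X^q - X\<close> in each variable: the index \<open>(i, e)\<close> stands for
  \<open>\<Prod>j. (X\<^sub>j^q - X\<^sub>j)^(i j) * X\<^sub>j^(e j)\<close> with all \<open>e j < q\<close>. Bounding \<open>\<Sum>j. i j\<close> instead of the total degree makes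
  the dimension an exact multiple of \<open>q^m\<close>, and along lines of \<open>K^m\<close> the polynomial \<open>X^q - X\<close> is only scaled.\<close>

definition adic_index :: "((nat \<Rightarrow> nat) \<times> (nat \<Rightarrow> nat)) set" where
  "adic_index = simplex m s \<times> ({..<m} \<rightarrow>\<^sub>E {..<q})"

definition adic_basis :: "(nat \<Rightarrow> nat) \<times> (nat \<Rightarrow> nat) \<Rightarrow> nat \<Rightarrow> 'a poly" where
  "adic_basis x j = vanish_poly ^ fst x j * monom 1 (snd x j)"

abbreviation restr :: "((nat \<Rightarrow> nat) \<times> (nat \<Rightarrow> nat) \<Rightarrow> 'a) \<Rightarrow> (nat \<Rightarrow> 'a) \<Rightarrow> (nat \<Rightarrow> 'a) \<Rightarrow> 'a poly" where
  "restr \<equiv> line_restr m adic_index adic_basis"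

abbreviation hasse :: "((nat \<Rightarrow> nat) \<times> (nat \<Rightarrow> nat) \<Rightarrow> 'a) \<Rightarrow> (nat \<Rightarrow> 'a) \<Rightarrow> (nat \<Rightarrow> nat) \<Rightarrow> 'a" where
  "hasse \<equiv> hasse_deriv m adic_index adic_basis"

abbreviation points :: "(nat \<Rightarrow> 'a) set" where
  "points \<equiv> {..<m} \<rightarrow>\<^sub>E K"

lemma finite_adic_index: "finite adic_index"
  by (auto simp: adic_index_def finite_simplex intro!: finite_PiE)

lemma card_adic_index: "card adic_index = card (simplex m s) * q ^ m"
  by (simp add: adic_index_def card_cartesian_product card_PiE)

subsection \<open>Degrees\<close>

lemma degree_adic_basis_le: "degree (adic_basis x j) \<le> q * fst x j + snd x j"
proof -
  have "degree (adic_basis x j) \<le> degree vanish_poly * fst x j + snd x j"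
    unfolding adic_basis_def
    by (intro order.trans[OF degree_mult_le] add_mono degree_power_le degree_monom_le)
  also have "\<dots> \<le> q * fst x j + snd x j"
    by (intro add_right_mono mult_right_mono degree_vanish_poly_le) simp
  finally show ?thesis .
qed

lemma degree_prod_adic_basis_le:
  assumes x: "x \<in> adic_index"
  shows "degree (\<Prod>j<m. pcompose (adic_basis x j) [:p j, w j:]) \<le> q * (s - 1) + m * (q - 1)"
proof -
  have "degree (\<Prod>j<m. pcompose (adic_basis x j) [:p j, w j:]) \<le>
      (\<Sum>j<m. degree (pcompose (adic_basis x j) [:p j, w j:]))"
    by (rule degree_prod_sum_le[unfolded o_def]) simp
  also have "\<dots> \<le> (\<Sum>j<m. q * fst x j + (q - 1))"
  proof (rule sum_mono)
    fix j assume "j \<in> {..<m}"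
    then have "snd x j < q"
      using x PiE_mem[of "snd x" "{..<m}" "\<lambda>_. {..<q}" j] by (simp add: adic_index_def mem_Times_iff)
    moreover have "degree (pcompose (adic_basis x j) [:p j, w j:]) \<le> degree (adic_basis x j)"
      using mult_le_mono2[of "degree [:p j, w j:]" 1 "degree (adic_basis x j)"]
      by (simp add: degree_pcompose degree_pCons_eq_if)
    ultimately show "degree (pcompose (adic_basis x j) [:p j, w j:]) \<le> q * fst x j + (q - 1)"
      using degree_adic_basis_le[of x j] by linarith
  qed
  also have "\<dots> = q * (\<Sum>j<m. fst x j) + m * (q - 1)"
    by (subst sum.distrib) (simp add: sum_distrib_left)
  also have "(\<Sum>j<m. fst x j) < s"
    using x by (simp add: adic_index_def simplex_def mem_Times_iff)
  then have "q * (\<Sum>j<m. fst x j) + m * (q - 1) \<le> q * (s - 1) + m * (q - 1)"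
    by (intro add_right_mono mult_left_mono) linarith+
  finally show ?thesis .
qed

lemma degree_restr_less: "degree (restr c p w) < (s + m) * (q - 1)"
proof -
  have "degree (restr c p w) \<le> q * (s - 1) + m * (q - 1)"
    unfolding line_restr_def using finite_adic_index degree_prod_adic_basis_le
    by (intro degree_sum_le order.trans[OF degree_smult_le])
  also have "q * (s - 1) < s * (q - 1)"
    using s_pos s_less_q q_gt_1
    by (simp add: diff_mult_distrib diff_mult_distrib2 mult.commute diff_less_mono2)
  then have "q * (s - 1) + m * (q - 1) < (s + m) * (q - 1)"
    by (simp add: distrib_right)
  finally show ?thesis .
qed

subsection \<open>The group of messages\<close>

definition messages :: "((nat \<Rightarrow> nat) \<times> (nat \<Rightarrow> nat) \<Rightarrow> 'a) set" where
  "messages = {c. (\<forall>x\<in>adic_index. c x \<in> K) \<and> (\<forall>x. x \<notin> adic_index \<longrightarrow> c x = 0)}"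

lemma messages_outside: "c \<in> messages \<Longrightarrow> x \<notin> adic_index \<Longrightarrow> c x = 0"
  by (cases x) (simp add: messages_def)

lemma messages_K: "c \<in> messages \<Longrightarrow> c x \<in> K"
  by (cases "x \<in> adic_index") (simp_all add: messages_outside, simp add: messages_def)

lemma bij_messages:
  "bij_betw (\<lambda>c. restrict c adic_index) messages (adic_index \<rightarrow>\<^sub>E K)"
  by (rule bij_betwI[where g = "\<lambda>c x. if x \<in> adic_index then c x else 0"])
     (auto simp: messages_def fun_eq_iff PiE_def extensional_def)

lemma card_messages: "card messages = q ^ (card (simplex m s) * q ^ m)"
  by (simp add: bij_betw_same_card[OF bij_messages] card_PiE finite_adic_index card_K card_adic_index)

lemma xor_group_messages:
  assumes "CHAR('a) = 2"
  shows "xor_group messages"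
proof -
  have "finite messages"
    using bij_betw_finite[OF bij_messages] by (simp add: finite_PiE finite_adic_index finite_K)
  moreover have "c x + c x = 0" if "c \<in> messages" for c x
    using xor_groupD(4)[OF xor_group_K[OF assms] messages_K[OF that]] .
  ultimately show ?thesis
    by (auto simp: xor_group_def messages_def K_add fun_eq_iff)
qed

lemma pcompose_adic_basis:
  assumes "p \<in> K" "w \<in> K"
  shows "pcompose (adic_basis x j) [:p, w:] = smult (w ^ fst x j) (vanish_poly ^ fst x j * [:p, w:] ^ snd x j)"
  by (simp add: adic_basis_def pcompose_mult pcompose_power pcompose_monom_1 pcompose_vanish_poly
      assms smult_power)

lemma pcompose_adic_basis_K: "p \<in> K \<Longrightarrow> w \<in> K \<Longrightarrow> pcompose (adic_basis x j) [:p, w:] \<in> K_polys"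
  unfolding pcompose_adic_basis
  by (intro K_polys_smult K_polys_mult K_polys_power K_polys_affine K_power vanish_poly_K)

lemma restr_K: "c \<in> messages \<Longrightarrow> p \<in> points \<Longrightarrow> w \<in> points \<Longrightarrow> restr c p w \<in> K_polys"
  unfolding line_restr_def
  by (intro K_polys_sum K_polys_smult K_polys_prod pcompose_adic_basis_K) (auto simp: messages_def)

lemma hasse_K: "c \<in> messages \<Longrightarrow> y \<in> points \<Longrightarrow> hasse c y t \<in> K"
  unfolding hasse_deriv_def
  by (intro K_sum K_mult K_prod K_polysD[OF pcompose_adic_basis_K]) (auto simp: messages_def)

subsection \<open>Directional derivatives separate messages\<close>

lemma coeff_prod_adic_basis:
  assumes p: "p \<in> points" and w: "w \<in> points" and t: "t \<le> (\<Sum>j<m. fst x j)"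
  shows "coeff (\<Prod>j<m. pcompose (adic_basis x j) [:p j, w j:]) t =
    (if (\<Sum>j<m. fst x j) = t then (- 1) ^ t * (\<Prod>j<m. w j ^ fst x j) * (\<Prod>j<m. p j ^ snd x j) else 0)"
proof -
  have "pcompose (adic_basis x j) [:p j, w j:] =
      smult (w j ^ fst x j) (vanish_poly ^ fst x j * [:p j, w j:] ^ snd x j)" if "j < m" for j
    using p w that by (intro pcompose_adic_basis) auto
  then have "(\<Prod>j<m. pcompose (adic_basis x j) [:p j, w j:]) =
      smult (\<Prod>j<m. w j ^ fst x j) (vanish_poly ^ (\<Sum>j<m. fst x j) * (\<Prod>j<m. [:p j, w j:] ^ snd x j))"
    by (simp add: prod_smult prod.distrib power_sum)
  moreover have "coeff (\<Prod>j<m. [:p j, w j:] ^ snd x j) 0 = (\<Prod>j<m. p j ^ snd x j)"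
    by (simp add: poly_0_coeff_0[symmetric] poly_prod)
  ultimately show ?thesis
    using coeff_vanish_poly_power_mult[OF t, of "\<Prod>j<m. [:p j, w j:] ^ snd x j"] by auto
qed

lemma coeff_restr_lowest:
  assumes p: "p \<in> points" and w: "w \<in> points" and t: "t < s"
    and low: "\<And>x. x \<in> adic_index \<Longrightarrow> (\<Sum>j<m. fst x j) < t \<Longrightarrow> c x = 0"
  shows "coeff (restr c p w) t = (- 1) ^ t *
    (\<Sum>e\<in>{..<m} \<rightarrow>\<^sub>E {..<q}. (\<Sum>i\<in>exponents m t. c (i, e) * (\<Prod>j<m. w j ^ i j)) * (\<Prod>j<m. p j ^ e j))"
proof -
  let ?E = "{..<m} \<rightarrow>\<^sub>E {..<q} :: (nat \<Rightarrow> nat) set"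
  let ?coeff = "\<lambda>x. coeff (\<Prod>j<m. pcompose (adic_basis x j) [:p j, w j:]) t"
  have "coeff (restr c p w) t = (\<Sum>x\<in>adic_index. c x * ?coeff x)"
    by (simp add: line_restr_def coeff_sum)
  also have "\<dots> = (\<Sum>x\<in>exponents m t \<times> ?E. c x * ?coeff x)"
  proof (rule sum.mono_neutral_right[OF finite_adic_index])
    show "exponents m t \<times> ?E \<subseteq> adic_index"
      unfolding adic_index_def by (rule Sigma_mono[OF exponents_subset_simplex[OF t] order.refl])
    show "\<forall>x\<in>adic_index - exponents m t \<times> ?E. c x * ?coeff x = 0"
    proof
      fix x assume x: "x \<in> adic_index - exponents m t \<times> ?E"
      then have "fst x \<in> simplex m s" "fst x \<notin> exponents m t"
        unfolding adic_index_def Diff_iff mem_Times_iff by blast+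
      then have "(\<Sum>j<m. fst x j) \<noteq> t"
        by (simp add: simplex_def exponents_def)
      then show "c x * ?coeff x = 0"
        using low[of x] coeff_prod_adic_basis[OF p w, of t x] x by (cases "(\<Sum>j<m. fst x j) < t") auto
    qed
  qed
  also have "\<dots> = (\<Sum>i\<in>exponents m t. \<Sum>e\<in>?E. c (i, e) * ?coeff (i, e))"
    by (simp add: sum.cartesian_product)
  also have "\<dots> = (\<Sum>e\<in>?E. \<Sum>i\<in>exponents m t. c (i, e) * ?coeff (i, e))"
    by (rule sum.swap)
  also have "\<dots> = (\<Sum>e\<in>?E. \<Sum>i\<in>exponents m t. (- 1) ^ t * (c (i, e) * (\<Prod>j<m. w j ^ i j) * (\<Prod>j<m. p j ^ e j)))"
    by (intro sum.cong refl) (simp add: coeff_prod_adic_basis[OF p w] exponents_def mult_ac)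
  finally show ?thesis
    by (simp add: sum_distrib_left sum_distrib_right)
qed

lemma message_eq_0:
  assumes c: "c \<in> messages"
    and zero: "\<And>p w a. p \<in> points \<Longrightarrow> w \<in> points \<Longrightarrow> w 0 = 1 \<Longrightarrow> a < s \<Longrightarrow> coeff (restr c p w) a = 0"
  shows "c = 0"
proof -
  have "\<forall>x\<in>adic_index. (\<Sum>j<m. fst x j) = t \<longrightarrow> c x = 0" if "t < s" for t
    using that
  proof (induction t rule: less_induct)
    case (less t)
    have low: "c x = 0" if "x \<in> adic_index" "(\<Sum>j<m. fst x j) < t" for x
      using less that by simp
    have "c (i, e) = 0" if i: "i \<in> exponents m t" and e: "e \<in> {..<m} \<rightarrow>\<^sub>E {..<q}" for i e
    proof (rule homogeneous_vanishing[OF _ i])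
      fix w assume w: "w \<in> points" "w 0 = 1"
      show "(\<Sum>i\<in>exponents m t. c (i, e) * (\<Prod>j<m. w j ^ i j)) = 0"
      proof (rule coeff_eq_0_of_vanishing_on_box[where A = "{..<m}" and S = "\<lambda>_. K" and d = "\<lambda>_. q",
            OF _ _ _ e])
        fix p assume p: "p \<in> points"
        show "(\<Sum>e\<in>{..<m} \<rightarrow>\<^sub>E {..<q}. (\<Sum>i\<in>exponents m t. c (i, e) * (\<Prod>j<m. w j ^ i j)) * (\<Prod>j<m. p j ^ e j)) = 0"
          using zero[OF p w less.prems] coeff_restr_lowest[OF p w(1) less.prems low] by simp
      qed (auto simp: finite_K card_K)
    qed (use less.prems s_less_q m_ge_2 in auto)
    then show ?case
      by (auto simp: adic_index_def simplex_def exponents_def)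
  qed
  then have "c x = 0" if "x \<in> adic_index" for x
    using that by (auto simp: adic_index_def simplex_def)
  then have "c x = 0" for x
    using messages_outside[OF c] by (cases "x \<in> adic_index") simp_all
  then show ?thesis
    by (simp add: fun_eq_iff)
qed

subsection \<open>Planes through a line\<close>

definition line_pt :: "(nat \<Rightarrow> 'a) \<Rightarrow> 'a \<Rightarrow> (nat \<Rightarrow> 'a) \<Rightarrow> nat \<Rightarrow> 'a" where
  "line_pt p \<tau> w = restrict (\<lambda>j. p j + \<tau> * w j) {..<m}"

lemma line_pt_in: "p \<in> points \<Longrightarrow> w \<in> points \<Longrightarrow> \<tau> \<in> K \<Longrightarrow> line_pt p \<tau> w \<in> points"
  unfolding line_pt_def by (auto intro!: K_add K_mult)

text \<open>Directions \<open>v\<close> are normalised by \<open>v 0 = 1\<close>. The lines through \<open>p\<close> of directions \<open>v + \<mu> * u\<close>, where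
  \<open>u \<in> plane_dirs\<close> and \<open>\<mu> \<noteq> 0\<close>, meet only in \<open>p\<close>.\<close>

definition plane_dirs :: "(nat \<Rightarrow> 'a) set" where
  "plane_dirs = {u \<in> points. u 0 = 0 \<and> u 1 = 1}"

definition plane_pt :: "(nat \<Rightarrow> 'a) \<Rightarrow> (nat \<Rightarrow> 'a) \<Rightarrow> (nat \<Rightarrow> 'a) \<times> 'a \<times> 'a \<Rightarrow> nat \<Rightarrow> 'a" where
  "plane_pt p v = (\<lambda>(u, \<mu>, \<tau>). line_pt p \<tau> (line_pt v \<mu> u))"

lemma plane_pt_in:
  "p \<in> points \<Longrightarrow> v \<in> points \<Longrightarrow> u \<in> plane_dirs \<Longrightarrow> \<mu> \<in> K \<Longrightarrow> \<tau> \<in> K \<Longrightarrow> plane_pt p v (u, \<mu>, \<tau>) \<in> points"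
  unfolding plane_pt_def prod.case by (intro line_pt_in) (simp_all add: plane_dirs_def)

lemma card_plane_dirs: "card plane_dirs = q ^ (m - 2)"
proof -
  obtain n where m: "m = Suc (Suc n)"
    using m_ge_2 by (metis add_2_eq_Suc le_Suc_ex)
  have "plane_dirs = (\<Pi>\<^sub>E j\<in>{..<m}. if j = 0 then {0} else if j = 1 then {1} else K)"
  proof (intro equalityI subsetI)
    fix u assume "u \<in> plane_dirs"
    then show "u \<in> (\<Pi>\<^sub>E j\<in>{..<m}. if j = 0 then {0} else if j = 1 then {1} else K)"
      by (simp add: plane_dirs_def PiE_iff)
  next
    fix u assume u: "u \<in> (\<Pi>\<^sub>E j\<in>{..<m}. if j = 0 then {0} else if j = 1 then {1} else K)"
    have "u 0 = 0" "u 1 = 1"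
      using PiE_mem[OF u, of 0] PiE_mem[OF u, of 1] m_ge_2 by simp_all
    moreover have "u j \<in> K" if "j < m" for j
      using PiE_mem[OF u, of j] that by (cases "j = 0"; cases "j = 1") simp_all
    ultimately show "u \<in> plane_dirs"
      using u by (simp add: plane_dirs_def PiE_iff)
  qed
  then show ?thesis
    by (simp add: m card_PiE prod.lessThan_Suc_shift card_K del: prod.lessThan_Suc)
qed

lemma finite_plane_dirs: "finite plane_dirs"
  by (rule finite_subset[of _ points]) (auto simp: plane_dirs_def finite_K intro: finite_PiE)

lemma inj_on_plane_pt:
  assumes v: "v 0 = 1"
  shows "inj_on (plane_pt p v) (plane_dirs \<times> (K - {0}) \<times> (K - {0}))"
proof (rule inj_onI)
  fix z z' assume z: "z \<in> plane_dirs \<times> (K - {0}) \<times> (K - {0})" "z' \<in> plane_dirs \<times> (K - {0}) \<times> (K - {0})"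
    and pt_eq: "plane_pt p v z = plane_pt p v z'"
  obtain u \<mu> \<tau> u' \<mu>' \<tau>' where z_eq: "z = (u, \<mu>, \<tau>)" "z' = (u', \<mu>', \<tau>')"
    by (cases z, cases z')
  have u: "u \<in> plane_dirs" "u' \<in> plane_dirs" and nz: "\<mu> \<noteq> 0" "\<tau> \<noteq> 0"
    and eq: "line_pt p \<tau> (line_pt v \<mu> u) = line_pt p \<tau>' (line_pt v \<mu>' u')"
    using z pt_eq by (auto simp: z_eq plane_pt_def)
  have coord: "\<tau> * (v j + \<mu> * u j) = \<tau>' * (v j + \<mu>' * u' j)" if "j < m" for j
    using fun_cong[OF eq, of j] that by (simp add: line_pt_def)
  have "\<tau> = \<tau>'"
    using coord[of 0] u v m_ge_2 by (simp add: plane_dirs_def)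
  moreover from this have "\<mu> = \<mu>'"
    using coord[of 1] u nz m_ge_2 by (simp add: plane_dirs_def)
  moreover from calculation have "u j = u' j" if "j < m" for j
    using coord[OF that] nz by simp
  then have "u = u'"
    using u by (intro extensionalityI[of _ "{..<m}"]) (auto simp: plane_dirs_def PiE_def)
  ultimately show "z = z'"
    by (simp add: z_eq)
qed

lemma ex_free_plane:
  assumes v: "v 0 = 1" and Z: "finite Z" "card Z < q ^ (m - 2) * (q - s)"
  obtains u M where "u \<in> plane_dirs" "M \<subseteq> K - {0}" "card M = s"
    "plane_pt p v ` ({u} \<times> M \<times> (K - {0})) \<inter> Z = {}"
proof -
  let ?D = "plane_dirs \<times> (K - {0}) \<times> (K - {0})"
  define W where "W = plane_pt p v -` Z \<inter> ?D"
  have card_W: "card W \<le> card Z"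
    unfolding W_def by (rule card_vimage_inj_on_le[OF inj_on_plane_pt[of v, OF v] Z(1)])
  have fin_W: "finite W"
    unfolding W_def using finite_plane_dirs finite_K by (intro finite_Int) auto
  define hit where "hit u = {\<mu>. \<exists>\<tau>. (u, \<mu>, \<tau>) \<in> W}" for u
  have hit_sub: "hit u \<subseteq> K - {0}" for u
    by (auto simp: hit_def W_def)
  have fin_hit: "finite (hit u)" for u
    using hit_sub finite_K by (meson finite_Diff finite_subset)
  have "(\<Sum>u\<in>plane_dirs. card (hit u)) = card (SIGMA u:plane_dirs. hit u)"
    using finite_plane_dirs fin_hit by simp
  also have "\<dots> \<le> card ((\<lambda>(u, \<mu>, \<tau>). (u, \<mu>)) ` W)"
    using fin_W by (intro card_mono) (force simp: hit_def)+
  also have "\<dots> < q ^ (m - 2) * (q - s)"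
    using card_image_le[OF fin_W] card_W Z(2) by (meson le_less_trans)
  finally have "\<not> (\<forall>u\<in>plane_dirs. q - s \<le> card (hit u))"
    using sum_bounded_below[of plane_dirs "q - s" "\<lambda>u. card (hit u)"] by (auto simp: card_plane_dirs)
  then obtain u where u: "u \<in> plane_dirs" "card (hit u) < q - s"
    by (auto simp: not_le)
  have "s \<le> card (K - {0} - hit u)"
    using u(2) by (simp only: card_Diff_subset[OF fin_hit hit_sub] card_K_nonzero)
  then obtain M where M: "M \<subseteq> K - {0} - hit u" "card M = s"
    using obtain_subset_with_card_n by metis
  then have "plane_pt p v ` ({u} \<times> M \<times> (K - {0})) \<inter> Z = {}"
    using u(1) by (fastforce simp: hit_def W_def)
  then show ?thesis
    using that u(1) M by blast
qed

lemma coeff_restr_eq_0_of_plane: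
  assumes M: "M \<subseteq> K - {0}" "card M = s" and a: "a < s"
    and zero: "\<And>y t. y \<in> plane_pt p v ` ({u} \<times> M \<times> (K - {0})) \<Longrightarrow> t \<in> simplex m (s + m) \<Longrightarrow> hasse c y t = 0"
  shows "coeff (restr c p v) a = 0"
proof (rule coeff_line_restr_eq_0[where M = M and u = u])
  show "finite M" using M(1) finite_K by (meson finite_Diff finite_subset)
  show "a < card M" using M(2) a by simp
  fix \<mu> assume \<mu>: "\<mu> \<in> M"
  show "restr c p (\<lambda>j. v j + \<mu> * u j) = 0"
  proof (rule line_restr_eq_0[where A = "K - {0}" and s = "s + m"])
    show "degree (restr c p (\<lambda>j. v j + \<mu> * u j)) < (s + m) * card (K - {0})"
      unfolding card_K_nonzero by (rule degree_restr_less)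
    fix \<tau> t assume \<tau>: "\<tau> \<in> K - {0}" and t: "t \<in> simplex m (s + m)"
    have "hasse c (\<lambda>j. p j + \<tau> * (v j + \<mu> * u j)) t = hasse c (plane_pt p v (u, \<mu>, \<tau>)) t"
      by (rule hasse_deriv_cong) (simp add: plane_pt_def line_pt_def)
    also have "\<dots> = 0"
      using \<mu> \<tau> by (intro zero t imageI) simp
    finally show "hasse c (\<lambda>j. p j + \<tau> * (v j + \<mu> * u j)) t = 0" .
  qed (simp add: finite_K)
qed

subsection \<open>The batch code\<close>

definition queries :: "((nat \<Rightarrow> 'a) \<times> (nat \<Rightarrow> 'a) \<times> nat) set" where
  "queries = points \<times> {v \<in> points. v 0 = 1} \<times> {..<s}"

definition dir_deriv :: "(nat \<Rightarrow> 'a) \<times> (nat \<Rightarrow> 'a) \<times> nat \<Rightarrow> ((nat \<Rightarrow> nat) \<times> (nat \<Rightarrow> nat) \<Rightarrow> 'a) \<Rightarrow> 'a" where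
  "dir_deriv = (\<lambda>(p, v, a) c. coeff (restr c p v) a)"

lemma additive_on_dir_deriv: "additive_on messages (dir_deriv z)"
  by (cases z) (simp add: dir_deriv_def additive_on_def line_restr_add)

lemma dir_deriv_K: "z \<in> queries \<Longrightarrow> dir_deriv z ` messages \<subseteq> K"
  unfolding queries_def dir_deriv_def by (elim SigmaE) (simp add: image_subset_iff K_polysD restr_K)

lemma separating_dir_deriv: "separating messages (dir_deriv ` queries)"
  unfolding determines_def
proof (intro ballI impI)
  fix c assume c: "c \<in> messages" and zero: "\<forall>f\<in>dir_deriv ` queries. f c = 0"
  show "c = 0"
  proof (rule message_eq_0[OF c])
    fix p w a assume "p \<in> points" "w \<in> points" "w 0 = 1" "a < s"
    then have "dir_deriv (p, w, a) \<in> dir_deriv ` queries"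
      by (intro imageI) (simp add: queries_def)
    from bspec[OF zero this] show "coeff (restr c p w) a = 0"
      by (simp add: dir_deriv_def)
  qed
qed

definition plane_serves :: "(nat \<Rightarrow> 'a) set \<Rightarrow> (nat \<Rightarrow> 'a) \<times> (nat \<Rightarrow> 'a) \<times> nat \<Rightarrow> bool" where
  "plane_serves R z \<longleftrightarrow> card R \<le> s * (q - 1) \<and>
     (\<forall>c. (\<forall>y\<in>R. \<forall>t\<in>simplex m (s + m). hasse c y t = 0) \<longrightarrow> dir_deriv z c = 0)"

lemma ex_plane_serves:
  assumes z: "z \<in> queries" and Z: "finite Z" "card Z < q ^ (m - 2) * (q - s)"
  shows "\<exists>R\<subseteq>points. plane_serves R z \<and> R \<inter> Z = {}"
proof -
  obtain p v a where p: "p \<in> points" and v: "v \<in> points" "v 0 = 1" and a: "a < s"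
    and z_eq: "z = (p, v, a)"
    using z by (auto simp: queries_def)
  obtain u M where u: "u \<in> plane_dirs" and M: "M \<subseteq> K - {0}" "card M = s"
    and free: "plane_pt p v ` ({u} \<times> M \<times> (K - {0})) \<inter> Z = {}"
    by (rule ex_free_plane[of v Z p, OF v(2) Z])
  let ?R = "plane_pt p v ` ({u} \<times> M \<times> (K - {0}))"
  have "finite M"
    using M(1) finite_K by (meson finite_Diff finite_subset)
  then have "card ?R \<le> card ({u} \<times> M \<times> (K - {0}))"
    using finite_K by (intro card_image_le) simp
  also have "\<dots> = s * (q - 1)"
    by (simp add: card_cartesian_product M(2) card_K_nonzero)
  finally have "card ?R \<le> s * (q - 1)" .
  moreover have "dir_deriv z c = 0" if "\<forall>y\<in>?R. \<forall>t\<in>simplex m (s + m). hasse c y t = 0" for c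
    unfolding z_eq dir_deriv_def prod.case by (rule coeff_restr_eq_0_of_plane[OF M a]) (use that in blast)
  ultimately have "plane_serves ?R z"
    by (simp add: plane_serves_def)
  moreover have "?R \<subseteq> points"
  proof (rule image_subsetI)
    fix x assume "x \<in> {u} \<times> M \<times> (K - {0})"
    then obtain \<mu> \<tau> where "x = (u, \<mu>, \<tau>)" "\<mu> \<in> K" "\<tau> \<in> K"
      using M(1) by auto
    then show "plane_pt p v x \<in> points"
      by (simp add: plane_pt_in p v(1) u)
  qed
  ultimately show ?thesis
    using free by blast
qed

lemma batch_servable_planes:
  assumes k: "k * (s * (q - 1)) \<le> q ^ (m - 2) * (q - s)"
  shows "batch_servable k points queries plane_serves"
proof (rule batch_servable_greedy)
  fix z \<R> assume z: "z \<in> queries" and \<R>: "finite \<R>" "card \<R> < k"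
    and used: "\<And>R. R \<in> \<R> \<Longrightarrow> R \<subseteq> points \<and> (\<exists>z'\<in>queries. plane_serves R z')"
  have "finite points"
    by (simp add: finite_PiE finite_K)
  then have "finite (\<Union>\<R>)"
    using used \<R>(1) by (auto intro: finite_subset)
  have "card (\<Union>\<R>) \<le> (\<Sum>R\<in>\<R>. card R)"
    by (rule card_Union_le_sum_card)
  also have "\<dots> \<le> card \<R> * (s * (q - 1))"
    using sum_bounded_above[of \<R> card "s * (q - 1)"] used by (auto simp: plane_serves_def)
  also have "\<dots> < k * (s * (q - 1))"
    using \<R>(2) s_pos q_gt_1 by simp
  finally have "card (\<Union>\<R>) < q ^ (m - 2) * (q - s)"
    using k by simp
  then show "\<exists>R\<subseteq>points. plane_serves R z \<and> R \<inter> \<Union>\<R> = {}"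
    using \<open>finite (\<Union>\<R>)\<close> z by (intro ex_plane_serves)
qed

theorem has_multiplicity_batch_code:
  assumes CHAR_2: "CHAR('a) = 2" and q: "q = 2 ^ l" and k: "k * (s * (q - 1)) \<le> q ^ (m - 2) * (q - s)"
  shows "has_batch_code (q ^ m * (card (simplex m (s + m)) * l)) (card (simplex m s) * q ^ m * l) k"
proof -
  have "has_batch_code (card points * (card (simplex m (s + m)) * l)) (card (simplex m s) * q ^ m * l) k"
  proof (rule batch_code_from_additive_maps[where V = messages and K = K and Q = queries and \<Psi> = dir_deriv
        and \<Phi> = "\<lambda>y t c. hasse c y t"])
    show "xor_group messages" "xor_group K"
      by (rule xor_group_messages[OF CHAR_2], rule xor_group_K[OF CHAR_2])
    show "card messages = 2 ^ (card (simplex m s) * q ^ m * l)"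
      unfolding card_messages by (simp add: q power_mult[symmetric] mult_ac)
    show "card K = 2 ^ l"
      by (simp add: card_K q)
    show "finite points" "finite (simplex m (s + m))"
      by (simp_all add: finite_PiE finite_K finite_simplex)
    show "additive_on messages (\<lambda>c. hasse c y t)" for y t
      by (simp add: additive_on_def hasse_deriv_add)
    show "(\<lambda>c. hasse c y t) ` messages \<subseteq> K" if "y \<in> points" for y t
      unfolding image_subset_iff using hasse_K that by simp
    show "batch_servable k points queries
        (\<lambda>R z. determines messages ((\<lambda>(y, t) c. hasse c y t) ` (R \<times> simplex m (s + m))) (dir_deriv z))"
      by (rule batch_servable_vimage[OF batch_servable_planes[OF k], where g = "\<lambda>z. z" and e = "\<lambda>y. y"])
         (auto simp: plane_serves_def determines_def inf.absorb2)
  qed (simp_all add: additive_on_dir_deriv dir_deriv_K separating_dir_deriv)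
  then show ?thesis
    by (simp add: card_PiE card_K)
qed

end

section \<open>Parities over lines with directions on a conic\<close>

text \<open>The line through \<open>p\<close> in direction \<open>(1, x, x\<^sup>2)\<close> is encoded by \<open>x\<close> and its point with first
  coordinate \<open>0\<close>.\<close>

definition conic_line :: "'a::field \<Rightarrow> 'a \<times> 'a \<times> 'a \<Rightarrow> 'a \<times> 'a \<times> 'a" where
  "conic_line x p = (x, fst (snd p) - fst p * x, snd (snd p) - fst p * x\<^sup>2)"

definition line_points :: "('a::field \<times> 'a \<times> 'a) set \<Rightarrow> 'a \<times> 'a \<times> 'a \<Rightarrow> ('a \<times> 'a \<times> 'a) set" where
  "line_points Q L = {y \<in> Q. conic_line (fst L) y = L}"

lemma conic_line_eqE:
  assumes "conic_line x y = conic_line x p"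
  obtains \<tau> where "y = (fst p + \<tau>, fst (snd p) + \<tau> * x, snd (snd p) + \<tau> * x\<^sup>2)"
proof (rule that[of "fst y - fst p"])
  show "y = (fst p + (fst y - fst p), fst (snd p) + (fst y - fst p) * x, snd (snd p) + (fst y - fst p) * x\<^sup>2)"
    using assms by (cases y; cases p) (simp add: conic_line_def algebra_simps)
qed

text \<open>Three distinct points of a conic are not collinear.\<close>

lemma conic_directions_independent:
  fixes a b x x' z :: "'a::field"
  assumes nz: "a \<noteq> 0" "b \<noteq> 0"
    and eq: "a * (x - z) = b * (x' - z)" "a * (x\<^sup>2 - z\<^sup>2) = b * (x'\<^sup>2 - z\<^sup>2)"
  shows "x = x'"
proof -
  have "a * (x - z) * (x + z) = b * (x' - z) * (x' + z)"
    using eq(2) by (simp add: algebra_simps power2_eq_square)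
  then have "a * (x - z) * (x + z) = a * (x - z) * (x' + z)"
    unfolding eq(1) .
  then show ?thesis
    using eq(1) nz by auto
qed

lemma conic_lines_meet_unique:
  fixes p p' y y' :: "'a::field \<times> 'a \<times> 'a"
  assumes y: "y \<noteq> p" "conic_line x y = conic_line x p" "conic_line z y = conic_line z p'"
    and y': "y' \<noteq> p" "conic_line x' y' = conic_line x' p" "conic_line z y' = conic_line z p'"
  shows "x = x'"
proof -
  obtain a where a: "y = (fst p + a, fst (snd p) + a * x, snd (snd p) + a * x\<^sup>2)"
    by (rule conic_line_eqE[OF y(2)])
  obtain b where b: "y' = (fst p + b, fst (snd p) + b * x', snd (snd p) + b * x'\<^sup>2)"
    by (rule conic_line_eqE[OF y'(2)])
  have "a \<noteq> 0" "b \<noteq> 0"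
    using y(1) y'(1) unfolding a b by (auto simp: prod_eq_iff)
  moreover have "conic_line z y = conic_line z y'"
    using y(3) y'(3) by simp
  then have "a * (x - z) = b * (x' - z)" "a * (x\<^sup>2 - z\<^sup>2) = b * (x'\<^sup>2 - z\<^sup>2)"
    unfolding a b conic_line_def by (simp_all add: algebra_simps)
  ultimately show ?thesis
    by (rule conic_directions_independent)
qed

definition conic_block ::
    "('a::field \<times> 'a \<times> 'a) set \<Rightarrow> 'a \<times> 'a \<times> 'a \<Rightarrow> 'a \<Rightarrow> ('a \<times> 'a \<times> 'a + 'a \<times> 'a \<times> 'a) set" where
  "conic_block Q p x = insert (Inr (conic_line x p)) (Inl ` (line_points Q (conic_line x p) - {p}))"

lemma conic_block_meetE:
  assumes "conic_block Q p x \<inter> conic_block Q p' z \<noteq> {}"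
  obtains y where "y \<noteq> p" "conic_line x y = conic_line x p" "conic_line z y = conic_line z p'"
proof -
  obtain b where b: "b \<in> conic_block Q p x" "b \<in> conic_block Q p' z"
    using assms by blast
  show ?thesis
  proof (cases b)
    case (Inl y)
    then show ?thesis
      using b that[of y] by (auto simp: conic_block_def line_points_def conic_line_def)
  next
    case (Inr L)
    then have "conic_line x p = conic_line z p'"
      using b by (auto simp: conic_block_def)
    then have "x = z" and same: "conic_line z p = conic_line z p'"
      by (auto simp: conic_line_def)
    let ?y = "(fst p + 1, fst (snd p) + z, snd (snd p) + z\<^sup>2)"
    have "conic_line z ?y = conic_line z p" "?y \<noteq> p"
      by (auto simp: conic_line_def algebra_simps prod_eq_iff)
    then show ?thesis
      using that[of ?y] \<open>x = z\<close> same by simp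
  qed
qed

lemma conic_block_meet_unique:
  assumes "conic_block Q p x \<inter> conic_block Q p' z \<noteq> {}" "conic_block Q p x' \<inter> conic_block Q p' z \<noteq> {}"
  shows "x = x'"
  using conic_block_meetE[OF assms(1)] conic_block_meetE[OF assms(2)] conic_lines_meet_unique by metis

definition bit_space :: "'p set \<Rightarrow> ('p \<Rightarrow> bit) set" where
  "bit_space Q = {f. \<forall>p. p \<notin> Q \<longrightarrow> f p = 0}"

lemma bij_bit_space: "bij_betw (\<lambda>f. {p. f p \<noteq> 0}) (bit_space Q) (Pow Q)"
  by (rule bij_betwI[where g = "\<lambda>A p. of_bool (p \<in> A)"]) (auto simp: bit_space_def)

lemma card_bit_space: "finite Q \<Longrightarrow> card (bit_space Q) = 2 ^ card Q"
  using bij_betw_same_card[OF bij_bit_space[of Q]] by (simp add: card_Pow)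

lemma xor_group_bit_space: "finite Q \<Longrightarrow> xor_group (bit_space Q)"
  using bij_betw_finite[OF bij_bit_space[of Q]] by (auto simp: xor_group_def bit_space_def fun_eq_iff)

fun bit_or_parity ::
    "('a::field \<times> 'a \<times> 'a) set \<Rightarrow> 'a \<times> 'a \<times> 'a + 'a \<times> 'a \<times> 'a \<Rightarrow> ('a \<times> 'a \<times> 'a \<Rightarrow> bit) \<Rightarrow> bit" where
  "bit_or_parity Q (Inl p) f = f p"
| "bit_or_parity Q (Inr L) f = (\<Sum>y\<in>line_points Q L. f y)"

lemma additive_on_bit_or_parity: "additive_on V (bit_or_parity Q t)"
  by (cases t) (auto simp only: additive_on_def bit_or_parity.simps plus_fun_def sum.distrib)

lemma conic_block_determines:
  assumes Q: "finite Q" "p \<in> Q"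
  shows "determines V (bit_or_parity Q ` conic_block Q p x) (\<lambda>f. f p)"
  unfolding determines_def
proof (intro ballI impI)
  fix f assume zero: "\<forall>\<phi>\<in>bit_or_parity Q ` conic_block Q p x. \<phi> f = 0"
  let ?L = "line_points Q (conic_line x p)"
  have "(\<Sum>y\<in>?L. f y) = 0"
    using zero by (simp add: conic_block_def)
  moreover have "(\<Sum>y\<in>?L. f y) = f p + (\<Sum>y\<in>?L - {p}. f y)"
    using Q by (intro sum.remove) (auto simp: line_points_def conic_line_def)
  moreover have "(\<Sum>y\<in>?L - {p}. f y) = 0"
    using zero by (intro sum.neutral) (simp add: conic_block_def)
  ultimately show "f p = 0"
    by simp
qed

lemma batch_servable_conic:
  fixes Q :: "('a::field \<times> 'a \<times> 'a) set"
  assumes D: "finite D" and T: "\<And>p x. p \<in> Q \<Longrightarrow> x \<in> D \<Longrightarrow> conic_block Q p x \<subseteq> T"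
  shows "batch_servable (card D) T Q (\<lambda>R p. \<exists>x\<in>D. R = conic_block Q p x)"
proof (rule batch_servable_greedy)
  fix p \<R> assume p: "p \<in> Q" and \<R>: "finite \<R>" "card \<R> < card D"
    and used: "\<And>R. R \<in> \<R> \<Longrightarrow> R \<subseteq> T \<and> (\<exists>p'\<in>Q. \<exists>x\<in>D. R = conic_block Q p' x)"
  define bad where "bad R = {x \<in> D. conic_block Q p x \<inter> R \<noteq> {}}" for R
  have "card (bad R) \<le> 1" if "R \<in> \<R>" for R
  proof -
    have "x = x'" if "x \<in> bad R" "x' \<in> bad R" for x x'
      using used[OF \<open>R \<in> \<R>\<close>] that conic_block_meet_unique unfolding bad_def by blast
    then show ?thesis
      using D by (auto simp: bad_def card_le_Suc0_iff_eq)
  qed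
  then have "card (\<Union>(bad ` \<R>)) \<le> card \<R>"
    using card_UN_le[OF \<R>(1), of bad] sum_bounded_above[of \<R> "\<lambda>R. card (bad R)" 1] by simp
  then have "card (\<Union>(bad ` \<R>)) < card D"
    using \<R>(2) by simp
  moreover have "\<Union>(bad ` \<R>) \<subseteq> D"
    by (auto simp: bad_def)
  ultimately obtain x where x: "x \<in> D" "x \<notin> \<Union>(bad ` \<R>)"
    by (metis less_irrefl subsetI subset_antisym)
  then have "conic_block Q p x \<inter> \<Union>\<R> = {}"
    by (auto simp: bad_def)
  then show "\<exists>R\<subseteq>T. (\<exists>x\<in>D. R = conic_block Q p x) \<and> R \<inter> \<Union>\<R> = {}"
    using T[OF p x(1)] x(1) by blast
qed

context finite_subfield
begin

lemma conic_block_subset: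
  assumes "Q \<subseteq> K \<times> K \<times> K" "D \<subseteq> K" "p \<in> Q" "x \<in> D"
  shows "conic_block Q p x \<subseteq> Q <+> (D \<times> K \<times> K)"
proof -
  have "conic_line x p \<in> D \<times> K \<times> K"
    using assms by (auto simp: conic_line_def intro!: K_diff K_mult K_power)
  then show ?thesis
    by (auto simp: conic_block_def line_points_def)
qed

theorem has_conic_batch_code:
  assumes n: "n \<le> q ^ 3" and d: "d \<le> q"
  shows "has_batch_code (n + d * q\<^sup>2) n d"
proof -
  have "n \<le> card (K \<times> K \<times> K)"
    using n by (simp add: card_cartesian_product card_K power3_eq_cube)
  then obtain Q where Q: "Q \<subseteq> K \<times> K \<times> K" "card Q = n" "finite Q"
    using obtain_subset_with_card_n by metis
  obtain D where D: "D \<subseteq> K" "card D = d" "finite D"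
    using obtain_subset_with_card_n[of d K] d card_K by metis
  define T where "T = Q <+> (D \<times> K \<times> K)"
  have serv: "batch_servable d T Q (\<lambda>R p. \<exists>x\<in>D. R = conic_block Q p x)"
    unfolding D(2)[symmetric] T_def
    by (intro batch_servable_conic D(3) conic_block_subset[OF Q(1) D(1)])
  have "has_batch_code (card T) n d"
  proof (rule batch_code_from_functionals[where V = "bit_space Q" and \<Psi> = "\<lambda>p f. f p"
        and \<Phi> = "bit_or_parity Q"])
    show "xor_group (bit_space Q)" "card (bit_space Q) = 2 ^ n"
      using Q by (simp_all add: xor_group_bit_space card_bit_space)
    show "additive_on (bit_space Q) (\<lambda>f. f p)" for p
      by (simp add: additive_on_def)
    show "separating (bit_space Q) ((\<lambda>p f. f p) ` Q)"
      by (auto simp: determines_def bit_space_def fun_eq_iff)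
    show "finite T"
      using Q(3) D(3) finite_K by (simp add: T_def)
    show "additive_on (bit_space Q) (bit_or_parity Q t)" for t
      by (rule additive_on_bit_or_parity)
    show "batch_servable d T Q (\<lambda>R p. determines (bit_space Q) (bit_or_parity Q ` R) (\<lambda>f. f p))"
      by (rule batch_servable_vimage[OF serv, where g = "\<lambda>p. p" and e = "\<lambda>t. t"])
         (auto simp: inf.absorb2 conic_block_determines[OF Q(3)])
  qed
  moreover have "card T = n + d * q\<^sup>2"
    unfolding T_def using Q D finite_K
    by (simp add: card_Plus card_cartesian_product card_K power2_eq_square)
  ultimately show ?thesis
    by simp
qed

end

section \<open>Choice of parameters\<close>

lemma multiplicity_batch_code:
  assumes m: "2 \<le> m" and l: "0 < l" and s: "0 < s" "2 * s \<le> 2 ^ l" and k: "2 * k * s \<le> (2 ^ l) ^ (m - 2)"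
  shows "has_batch_code ((2 ^ l) ^ m * (card (simplex m (s + m)) * l))
    (card (simplex m s) * (2 ^ l) ^ m * l) k"
proof -
  obtain K :: "bit alg_closure set" where "finite_subfield K (2 ^ l)"
    by (rule ex_binary_field[OF l])
  then interpret finite_subfield K "2 ^ l" .
  interpret multiplicity_code K "2 ^ l" m s
    using m s by unfold_locales auto
  have "2 * (k * (s * (2 ^ l - 1))) = 2 * k * s * (2 ^ l - 1)"
    by simp
  also have "\<dots> \<le> (2 ^ l) ^ (m - 2) * (2 * (2 ^ l - s))"
    by (rule mult_le_mono[OF k]) (use s in linarith)
  finally have "k * (s * (2 ^ l - 1)) \<le> (2 ^ l) ^ (m - 2) * (2 ^ l - s)"
    by simp
  then show ?thesis
    by (intro has_multiplicity_batch_code refl) (simp add: CHAR_bit)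
qed

lemma conic_batch_code:
  assumes "0 < l" "n \<le> (2 ^ l) ^ 3" "d \<le> 2 ^ l"
  shows "has_batch_code (n + d * (2 ^ l)\<^sup>2) n d"
proof -
  obtain K :: "bit alg_closure set" where "finite_subfield K (2 ^ l)"
    by (rule ex_binary_field[OF assms(1)])
  then interpret finite_subfield K "2 ^ l" .
  show ?thesis
    by (rule has_conic_batch_code[OF assms(2,3)])
qed

lemma ex_simplex_bracket:
  fixes m n C :: nat
  assumes m: "0 < m" and n: "0 < n" and C: "0 < C"
  obtains s where "0 < s" "card (simplex m (s - 1)) * C < n" "n \<le> card (simplex m s) * C"
proof -
  define s where "s = (LEAST s. n \<le> card (simplex m s) * C)"
  have "(m * n) ^ m \<le> m ^ m * card (simplex m (m * n))"
    using m by (rule power_le_card_simplex)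
  then have "n ^ m \<le> card (simplex m (m * n))"
    using m by (simp add: power_mult_distrib)
  moreover have "n \<le> n ^ m"
    using m n by (intro self_le_power) auto
  ultimately have "n * 1 \<le> card (simplex m (m * n)) * C"
    using C by (intro mult_le_mono) auto
  then have upper: "n \<le> card (simplex m s) * C"
    unfolding s_def by (intro LeastI[of "\<lambda>s. n \<le> card (simplex m s) * C" "m * n"]) simp
  have "simplex m 0 = {}"
    by (simp add: simplex_def)
  then have s: "0 < s"
    using upper n by (cases s) auto
  then have "card (simplex m (s - 1)) * C < n"
    using not_less_Least[of "s - 1" "\<lambda>s. n \<le> card (simplex m s) * C"] unfolding s_def[symmetric] by simp
  then show ?thesis
    using that s upper by blast
qed

text \<open>Taking the least \<open>s\<close> for which the dimension reaches \<open>n\<close>, only the \<open>m + 1\<close> outer layers of the simplex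
  contribute to the redundancy.\<close>

lemma shortened_multiplicity_code:
  fixes m l n :: nat
  defines "q \<equiv> 2 ^ l"
  assumes m: "2 \<le> m" and l: "0 < l" and n: "0 < n"
  obtains s where "0 < s" "(s - 1) ^ m * (q ^ m * l) < m ^ m * n"
    "\<And>k. 2 * s \<le> q \<Longrightarrow> 2 * k * s \<le> q ^ (m - 2) \<Longrightarrow>
      \<exists>N\<ge>n. has_batch_code N n k \<and> N \<le> n + (m + 1) * (s + m) ^ (m - 1) * (q ^ m * l)"
proof -
  define dim where "dim s = card (simplex m s) * (q ^ m * l)" for s
  obtain s where s: "0 < s" and dim_less: "dim (s - 1) < n" and dim_s: "n \<le> dim s"
    unfolding dim_def by (rule ex_simplex_bracket[of m n "q ^ m * l"]) (use m l n in \<open>auto simp: q_def\<close>)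
  show ?thesis
  proof (rule that[OF s])
    have "(s - 1) ^ m * (q ^ m * l) \<le> m ^ m * card (simplex m (s - 1)) * (q ^ m * l)"
      using m by (intro mult_right_mono power_le_card_simplex) auto
    also have "\<dots> < m ^ m * n"
      using dim_less m by (simp add: dim_def mult.assoc)
    finally show "(s - 1) ^ m * (q ^ m * l) < m ^ m * n" .
  next
    fix k assume k: "2 * s \<le> q" "2 * k * s \<le> q ^ (m - 2)"
    have "has_batch_code (dim (s + m)) (dim s) k"
      using multiplicity_batch_code[OF m l s k[unfolded q_def]] by (simp add: dim_def q_def mult_ac)
    then have "has_batch_code (dim (s + m)) n k"
      using dim_s by (rule has_batch_code_shorten)
    moreover have "dim s \<le> dim (s + m)"
      unfolding dim_def by (intro mult_right_mono card_mono finite_simplex simplex_mono) auto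
    moreover have "card (simplex m (s + m)) \<le> card (simplex m (s - 1)) + (m + 1) * (s + m) ^ (m - 1)"
      using card_simplex_add_le[of "m - 1" "s - 1" "m + 1"] m s by simp
    then have "dim (s + m) \<le> (card (simplex m (s - 1)) + (m + 1) * (s + m) ^ (m - 1)) * (q ^ m * l)"
      unfolding dim_def by (rule mult_right_mono) simp
    then have "dim (s + m) \<le> dim (s - 1) + (m + 1) * (s + m) ^ (m - 1) * (q ^ m * l)"
      by (simp only: dim_def distrib_right)
    ultimately show "\<exists>N\<ge>n. has_batch_code N n k \<and> N \<le> n + (m + 1) * (s + m) ^ (m - 1) * (q ^ m * l)"
      using dim_s dim_less by (intro exI[of _ "dim (s + m)"]) auto
  qed
qed

lemma repeated_multiplicity_code:
  fixes m l n :: nat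
  defines "q \<equiv> 2 ^ l"
  assumes m: "3 \<le> m" and l: "0 < l" and n: "n \<le> q ^ m"
  shows "has_batch_code ((2 * k div q ^ (m - 2) + 1) * (q ^ m * (card (simplex m (1 + m)) * l))) n k"
proof -
  define k0 where "k0 = q ^ (m - 2) div 2"
  have "even (q ^ (m - 2))"
    using m l by (simp add: q_def)
  then have k0: "2 * k0 = q ^ (m - 2)"
    by (simp add: k0_def)
  have "2 * 1 \<le> (2::nat) ^ l"
    using l self_le_power[of "2::nat" l] by simp
  then have "has_batch_code (q ^ m * (card (simplex m (1 + m)) * l)) (card (simplex m 1) * q ^ m * l) k0"
    unfolding q_def using m l k0 by (intro multiplicity_batch_code) (auto simp: q_def)
  moreover have "n \<le> card (simplex m 1) * q ^ m * l"
  proof -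
    have "n \<le> 1 * q ^ m * 1"
      using n by simp
    also have "\<dots> \<le> card (simplex m 1) * q ^ m * l"
      using card_simplex_pos[of m 1] m l by (intro mult_le_mono) (auto simp: Suc_le_eq)
    finally show ?thesis .
  qed
  ultimately have code: "has_batch_code (q ^ m * (card (simplex m (1 + m)) * l)) n k0"
    by (rule has_batch_code_shorten)
  have "2 * k < (2 * k div q ^ (m - 2) + 1) * q ^ (m - 2)"
    using dividend_less_div_times[of "q ^ (m - 2)" "2 * k"] by (simp add: q_def)
  then have "k \<le> (2 * k div q ^ (m - 2) + 1) * k0"
    unfolding k0[symmetric] by linarith
  with has_batch_code_repeat[OF code] show ?thesis
    by (rule has_batch_code_mono)
qed

lemma ex_power_of_two:
  fixes x :: real
  assumes "x > 1"
  obtains l :: nat where "l > 0" "x \<le> 2 ^ l" "2 ^ l \<le> 2 * x" "log 2 x \<le> real l" "real l \<le> log 2 x + 1"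
proof -
  define l where "l = nat \<lceil>log 2 x\<rceil>"
  have pos: "log 2 x > 0"
    using assms by simp
  then have l: "log 2 x \<le> real l" "real l \<le> log 2 x + 1"
    unfolding l_def by linarith+
  have "x = 2 powr log 2 x"
    using assms by simp
  also have "\<dots> \<le> 2 powr real l"
    using l(1) by (intro powr_mono) auto
  finally have lower: "x \<le> 2 ^ l"
    by (simp add: powr_realpow)
  have "(2::real) ^ l = 2 powr real l"
    by (simp add: powr_realpow)
  also have "\<dots> \<le> 2 powr (log 2 x + 1)"
    using l(2) by (intro powr_mono) auto
  also have "\<dots> = 2 * x"
    using assms by (simp add: powr_add)
  finally have upper: "2 ^ l \<le> 2 * x" .
  show ?thesis
    by (rule that[OF _ lower upper l]) (use pos l(1) in linarith)
qed

text \<open>With \<open>L = log n\<close> and \<open>Q = n / L\<close>, the scales are \<open>q \<approx> x = Q powr (1/4 - \<alpha>/3)\<close> and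
  \<open>s \<approx> Y = Q powr (\<alpha>/3)\<close>.\<close>

lemma shortening_parameter_le:
  fixes x Y L :: real and n s q l :: nat
  assumes "1 \<le> x" "1 \<le> Y" "0 < L" and q: "x \<le> real q" and l: "L / 12 \<le> real l"
    and n: "real n = x ^ 4 * Y ^ 4 * L" and s: "(s - 1) ^ 4 * (q ^ 4 * l) < 4 ^ 4 * n"
  shows "real s \<le> 9 * Y"
proof -
  have "real (s - 1) ^ 4 * (x ^ 4 * (L / 12)) \<le> real (s - 1) ^ 4 * (real q ^ 4 * real l)"
    using assms by (intro mult_left_mono mult_mono power_mono) auto
  also have "\<dots> = real ((s - 1) ^ 4 * (q ^ 4 * l))"
    by simp
  also have "\<dots> < real (4 ^ 4 * n)"
    using s by (simp only: of_nat_less_iff)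
  also have "\<dots> = (4 * Y) ^ 4 * 12 * (x ^ 4 * (L / 12))"
    by (simp add: n)
  finally have "real (s - 1) ^ 4 < (4 * Y) ^ 4 * 12"
    using assms by (simp add: mult_less_cancel_right)
  also have "\<dots> \<le> (8 * Y) ^ 4"
    by (simp add: power_mult_distrib)
  finally have "real (s - 1) < 8 * Y"
    by (rule power_less_imp_less_base) (use assms in simp)
  then show ?thesis
    using \<open>1 \<le> Y\<close> by linarith
qed

lemma shortening_redundancy_le:
  fixes x Y L :: real and n N s q l :: nat
  assumes "1 \<le> Y" and q: "real q \<le> 2 * x" and l: "real l \<le> L" and s: "real s \<le> 9 * Y"
    and n: "real n = x ^ 4 * Y ^ 4 * L" and N: "N \<le> n + 5 * (s + 4) ^ 3 * (q ^ 4 * l)"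
  shows "real N - real n \<le> 5 * 13 ^ 3 * 2 ^ 4 * (real n / Y)"
proof -
  have "real N \<le> real (n + 5 * (s + 4) ^ 3 * (q ^ 4 * l))"
    using N by (simp only: of_nat_le_iff)
  then have "real N - real n \<le> 5 * (real s + 4) ^ 3 * (real q ^ 4 * real l)"
    by simp
  also have "\<dots> \<le> 5 * (13 * Y) ^ 3 * ((2 * x) ^ 4 * L)"
    using assms by (intro mult_mono power_mono) auto
  also have "\<dots> = 5 * 13 ^ 3 * 2 ^ 4 * (real n / Y)"
    using \<open>1 \<le> Y\<close> by (simp add: n power_mult_distrib power4_eq_xxxx power3_eq_cube)
  finally show ?thesis .
qed

lemma multiplicity_code_of_scales:
  fixes x Y L :: real and n k :: nat
  assumes Y: "1 \<le> Y" "18 * Y \<le> x" and L: "0 < L" "L / 12 \<le> log 2 x" "log 2 x + 1 \<le> L"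
    and n: "real n = x ^ 4 * Y ^ 4 * L" and k: "32 * real k * Y \<le> x\<^sup>2"
  shows "\<exists>N\<ge>n. has_batch_code N n k \<and> real N - real n \<le> 5 * 13 ^ 3 * 2 ^ 4 * (real n / Y)"
proof -
  have x: "1 < x"
    using Y by simp
  obtain l where l: "0 < l" "x \<le> 2 ^ l" "2 ^ l \<le> 2 * x" "L / 12 \<le> real l" "real l \<le> L"
    by (rule ex_power_of_two[OF x]) (use L in auto)
  define q :: nat where "q = 2 ^ l"
  have q: "x \<le> real q" "real q \<le> 2 * x"
    using l by (simp_all add: q_def)
  have "0 < real n"
    unfolding n using x Y L by (intro mult_pos_pos zero_less_power) auto
  then have n_pos: "0 < n"
    by simp
  obtain s where s: "0 < s" "(s - 1) ^ 4 * (q ^ 4 * l) < 4 ^ 4 * n"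
    and code: "\<And>k. 2 * s \<le> q \<Longrightarrow> 2 * k * s \<le> q ^ (4 - 2) \<Longrightarrow>
      \<exists>N\<ge>n. has_batch_code N n k \<and> N \<le> n + (4 + 1) * (s + 4) ^ (4 - 1) * (q ^ 4 * l)"
    by (rule shortened_multiplicity_code[of 4 l n, folded q_def, OF _ l(1) n_pos]) (simp, rule that)
  have s_le: "real s \<le> 9 * Y"
    by (rule shortening_parameter_le[OF _ _ _ q(1) l(4) n s(2)]) (use x Y L in auto)
  have "real (2 * s) \<le> real q"
    using s_le Y q by simp
  then have "2 * s \<le> q"
    by (simp only: of_nat_le_iff)
  moreover have "2 * k * s \<le> q ^ (4 - 2)"
  proof -
    have "real (2 * k * s) \<le> 2 * real k * (9 * Y)"
      using mult_left_mono[OF s_le, of "2 * real k"] by simp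
    also have "\<dots> \<le> 32 * real k * Y"
      using Y by (simp add: mult_right_mono)
    also have "\<dots> \<le> (real q)\<^sup>2"
      using q x by (intro order.trans[OF k] power_mono) auto
    finally have "real (2 * k * s) \<le> real (q\<^sup>2)"
      by simp
    then show ?thesis
      unfolding of_nat_le_iff by simp
  qed
  ultimately have "\<exists>N\<ge>n. has_batch_code N n k \<and> N \<le> n + (4 + 1) * (s + 4) ^ (4 - 1) * (q ^ 4 * l)"
    by (rule code)
  then obtain N where N: "n \<le> N" "has_batch_code N n k" "N \<le> n + 5 * (s + 4) ^ 3 * (q ^ 4 * l)"
    by auto
  with shortening_redundancy_le[OF Y(1) q(2) l(5) s_le n] show ?thesis
    by blast
qed

lemma copies_le:
  fixes w y :: real and k Q :: nat
  assumes "0 < y" "y \<le> real Q" "real k \<le> w * y" "1 \<le> w"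
  shows "real (2 * k div Q + 1) \<le> 3 * w"
proof -
  have "real (2 * k div Q) \<le> real (2 * k) / real Q"
    by (rule of_nat_div_le_of_nat)
  also have "\<dots> \<le> (2 * (w * y)) / y"
    using assms by (intro frac_le) auto
  also have "\<dots> = 2 * w"
    using assms by simp
  finally show ?thesis
    using assms by simp
qed

lemma repeated_code_of_scales:
  fixes x w L :: real and n k :: nat
  assumes x: "1 < x" "x ^ 4 = real n" and L: "log 2 x + 1 \<le> L" and k: "real k \<le> w * x\<^sup>2" and w: "1 \<le> w"
  shows "\<exists>N\<ge>n. has_batch_code N n k \<and> real N \<le> 48 * real (card (simplex 4 5)) * (w * real n * L)"
proof -
  define c where "c = card (simplex 4 5)"
  have c: "0 < c"
    by (simp add: c_def card_simplex_pos)
  obtain l where l: "0 < l" "x \<le> 2 ^ l" "2 ^ l \<le> 2 * x" "real l \<le> L"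
    by (rule ex_power_of_two[OF x(1)]) (use L in auto)
  define q :: nat where "q = 2 ^ l"
  have q: "x \<le> real q" "real q \<le> 2 * x"
    using l by (simp_all add: q_def)
  have "real n \<le> real (q ^ 4)"
    unfolding x(2)[symmetric] of_nat_power using q x by (intro power_mono) auto
  then have n: "n \<le> q ^ 4"
    by (simp only: of_nat_le_iff)
  define r where "r = 2 * k div q\<^sup>2 + 1"
  define N where "N = r * (q ^ 4 * (c * l))"
  have "has_batch_code N n k"
    using repeated_multiplicity_code[of 4 l n k] l(1) n by (simp add: q_def r_def c_def N_def)
  moreover have "n \<le> N"
  proof -
    have "n \<le> 1 * (q ^ 4 * (1 * 1))"
      using n by simp
    also have "\<dots> \<le> N"
      unfolding N_def using c l(1) by (intro mult_le_mono) (auto simp: r_def)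
    finally show ?thesis .
  qed
  moreover have "real r \<le> 3 * w"
    unfolding r_def by (rule copies_le[of "x\<^sup>2"]) (use x q k w in \<open>auto simp: power_mono\<close>)
  then have "real r * (real q ^ 4 * (real c * real l)) \<le> 3 * w * ((2 * x) ^ 4 * (real c * L))"
    using q l x w by (intro mult_mono power_mono) auto
  then have "real N \<le> 48 * real c * (w * real n * L)"
    by (simp add: N_def power_mult_distrib x(2) mult_ac)
  ultimately show ?thesis
    unfolding c_def by blast
qed

definition redundancy_bigo :: "(nat \<Rightarrow> nat) \<Rightarrow> (nat \<Rightarrow> real) \<Rightarrow> bool" where
  "redundancy_bigo kf r \<longleftrightarrow> (\<exists>Nf :: nat \<Rightarrow> nat. (\<forall>\<^sub>F n in at_top. has_batch_code (Nf n) n (kf n)) \<and>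
     (\<lambda>n. real (Nf n) - real n) \<in> O(r))"

lemma redundancy_bigoI:
  assumes "\<forall>\<^sub>F n in at_top. \<exists>N\<ge>n. has_batch_code N n (kf n) \<and> real N - real n \<le> C * r n"
  shows "redundancy_bigo kf r"
proof -
  obtain Nf where Nf: "\<forall>\<^sub>F n in at_top. n \<le> Nf n \<and> has_batch_code (Nf n) n (kf n) \<and>
      real (Nf n) - real n \<le> C * r n"
    using assms unfolding eventually_ex by blast
  have "(\<lambda>n. real (Nf n) - real n) \<in> O(r)"
  proof (rule bigoI[of _ "\<bar>C\<bar>"])
    show "\<forall>\<^sub>F n in at_top. norm (real (Nf n) - real n) \<le> \<bar>C\<bar> * norm (r n)"
      using Nf
    proof eventually_elim
      case (elim n)
      then show ?case
        using abs_ge_self[of "C * r n"] by (simp add: abs_mult)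
    qed
  qed
  moreover have "\<forall>\<^sub>F n in at_top. has_batch_code (Nf n) n (kf n)"
    using Nf by eventually_elim simp
  ultimately show ?thesis
    by (auto simp: redundancy_bigo_def)
qed

lemma redundancy_bigo_mono:
  assumes "redundancy_bigo kf r" "\<forall>\<^sub>F n in at_top. kf' n \<le> kf n"
  shows "redundancy_bigo kf' r"
proof -
  obtain Nf where Nf: "\<forall>\<^sub>F n in at_top. has_batch_code (Nf n) n (kf n)" "(\<lambda>n. real (Nf n) - real n) \<in> O(r)"
    using assms(1) by (auto simp: redundancy_bigo_def)
  have "\<forall>\<^sub>F n in at_top. has_batch_code (Nf n) n (kf' n)"
    using Nf(1) assms(2) by eventually_elim (rule has_batch_code_mono)
  then show ?thesis
    using Nf(2) by (auto simp: redundancy_bigo_def)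
qed

lemma powr_scales:
  fixes Q \<alpha> :: real
  assumes "0 < Q"
  shows "(Q powr (1/4 - \<alpha>/3)) ^ 4 * (Q powr (\<alpha>/3)) ^ 4 = Q"
    and "(Q powr (1/4 - \<alpha>/3))\<^sup>2 = Q powr (1/2 - \<alpha>) * Q powr (\<alpha>/3)"
proof -
  have "(Q powr (1/4 - \<alpha>/3)) ^ 4 * (Q powr (\<alpha>/3)) ^ 4 = Q powr (4 * (1/4 - \<alpha>/3) + 4 * (\<alpha>/3))"
    using assms unfolding powr_add by (simp add: powr_power)
  then show "(Q powr (1/4 - \<alpha>/3)) ^ 4 * (Q powr (\<alpha>/3)) ^ 4 = Q"
    using assms by simp
  have "(Q powr (1/4 - \<alpha>/3))\<^sup>2 = Q powr ((1/2 - \<alpha>) + \<alpha>/3)"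
    using assms by (simp add: powr_power)
  then show "(Q powr (1/4 - \<alpha>/3))\<^sup>2 = Q powr (1/2 - \<alpha>) * Q powr (\<alpha>/3)"
    by (simp only: powr_add)
qed

definition batch_size :: "real \<Rightarrow> nat \<Rightarrow> nat" where
  "batch_size \<alpha> n = nat \<lfloor>(real n / log 2 (real n)) powr (1/2 - \<alpha>) / 32\<rfloor>"

lemma batch_size_le: "real (batch_size \<alpha> n) \<le> (real n / log 2 (real n)) powr (1/2 - \<alpha>) / 32"
  unfolding batch_size_def by (rule of_nat_floor) simp

lemma batch_size_bigtheta:
  assumes "0 < \<alpha>" "\<alpha> < 1/2"
  shows "(\<lambda>n. real (batch_size \<alpha> n)) \<in> \<Theta>(\<lambda>n. (real n / log 2 (real n)) powr (1/2 - \<alpha>))"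
  unfolding batch_size_def using assms by real_asymp

lemma multiplicity_code_redundancy:
  assumes \<alpha>: "0 < \<alpha>" "\<alpha> < 1/3"
  shows "redundancy_bigo (batch_size \<alpha>) (\<lambda>n. real n powr (1 - \<alpha>/3) * log 2 (real n) powr (\<alpha>/3))"
proof (rule redundancy_bigoI)
  have "\<forall>\<^sub>F n in at_top. 1 < real n \<and> 0 < log 2 (real n)"
    by (intro eventually_conj; real_asymp)
  moreover have "\<forall>\<^sub>F n in at_top. 1 \<le> (real n / log 2 (real n)) powr (\<alpha>/3)"
    using \<alpha> by real_asymp
  moreover have "\<forall>\<^sub>F n in at_top.
      18 * (real n / log 2 (real n)) powr (\<alpha>/3) \<le> (real n / log 2 (real n)) powr (1/4 - \<alpha>/3)"
    using \<alpha> by real_asymp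
  moreover have "\<forall>\<^sub>F n in at_top. log 2 (real n) / 12 \<le> log 2 ((real n / log 2 (real n)) powr (1/4 - \<alpha>/3))"
    using \<alpha> by real_asymp
  moreover have "\<forall>\<^sub>F n in at_top. log 2 ((real n / log 2 (real n)) powr (1/4 - \<alpha>/3)) + 1 \<le> log 2 (real n)"
    using \<alpha> by real_asymp
  ultimately show "\<forall>\<^sub>F n in at_top. \<exists>N\<ge>n. has_batch_code N n (batch_size \<alpha> n) \<and>
      real N - real n \<le> 5 * 13 ^ 3 * 2 ^ 4 * (real n powr (1 - \<alpha>/3) * log 2 (real n) powr (\<alpha>/3))"
  proof eventually_elim
    case (elim n)
    define L where "L = log 2 (real n)"
    define Q where "Q = real n / L"
    define x where "x = Q powr (1/4 - \<alpha>/3)"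
    define Y where "Y = Q powr (\<alpha>/3)"
    have L: "0 < L" and Q: "0 < Q" and n: "real n = Q * L"
      using elim(1) by (auto simp: L_def Q_def)
    have n_scales: "real n = x ^ 4 * Y ^ 4 * L" and "x\<^sup>2 = Q powr (1/2 - \<alpha>) * Y"
      unfolding x_def Y_def powr_scales[OF Q] using n by simp_all
    moreover have "32 * real (batch_size \<alpha> n) \<le> Q powr (1/2 - \<alpha>)"
      using batch_size_le[of \<alpha> n] by (simp add: Q_def L_def)
    ultimately have "32 * real (batch_size \<alpha> n) * Y \<le> x\<^sup>2"
      by (simp add: Y_def mult_right_mono)
    with n_scales L elim
    have "\<exists>N\<ge>n. has_batch_code N n (batch_size \<alpha> n) \<and> real N - real n \<le> 5 * 13 ^ 3 * 2 ^ 4 * (real n / Y)"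
      by (intro multiplicity_code_of_scales[of Y x L]) (simp_all only: x_def Y_def Q_def L_def)
    moreover have "real n / Y = real n powr (1 - \<alpha>/3) * L powr (\<alpha>/3)"
      using elim(1) L by (simp add: Y_def Q_def powr_divide powr_diff)
    ultimately show ?case
      by (simp only: L_def)
  qed
qed

lemma conic_code_redundancy:
  assumes \<alpha>: "1/3 \<le> \<alpha>" "\<alpha> < 1/2"
  shows "redundancy_bigo (batch_size \<alpha>) (\<lambda>n. real n powr (1 - \<alpha>/3) * log 2 (real n) powr (\<alpha>/3))"
proof (rule redundancy_bigoI)
  have "\<forall>\<^sub>F n in at_top. 1 < real n"
    by real_asymp
  moreover have "\<forall>\<^sub>F n in at_top. (real n / log 2 (real n)) powr (1/2 - \<alpha>) / 32 \<le> real n powr (1/3)"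
    using \<alpha> by real_asymp
  moreover have "\<forall>\<^sub>F n in at_top. (real n / log 2 (real n)) powr (1/2 - \<alpha>) / 32 * (2 * real n powr (1/3))\<^sup>2 \<le>
      1 * (real n powr (1 - \<alpha>/3) * log 2 (real n) powr (\<alpha>/3))"
    using \<alpha> by real_asymp
  ultimately show "\<forall>\<^sub>F n in at_top. \<exists>N\<ge>n. has_batch_code N n (batch_size \<alpha> n) \<and>
      real N - real n \<le> 1 * (real n powr (1 - \<alpha>/3) * log 2 (real n) powr (\<alpha>/3))"
  proof eventually_elim
    case (elim n)
    have "1 < real n powr (1/3)"
      using elim(1) by (intro gr_one_powr) auto
    then obtain l where l: "0 < l" "real n powr (1/3) \<le> 2 ^ l" "2 ^ l \<le> 2 * real n powr (1/3)"
      using ex_power_of_two by blast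
    have "real n = (real n powr (1/3)) ^ 3"
      using elim(1) by (simp add: powr_power)
    also have "\<dots> \<le> real ((2 ^ l) ^ 3)"
      using power_mono[OF l(2), of 3] by simp
    finally have n: "n \<le> (2 ^ l) ^ 3"
      by (simp only: of_nat_le_iff)
    have "real (batch_size \<alpha> n) \<le> real (2 ^ l)"
      unfolding of_nat_power of_nat_numeral using batch_size_le[of \<alpha> n] elim(2) l(2) by linarith
    then have k: "batch_size \<alpha> n \<le> 2 ^ l"
      by (simp only: of_nat_le_iff)
    have "real (n + batch_size \<alpha> n * (2 ^ l)\<^sup>2) - real n = real (batch_size \<alpha> n) * (2 ^ l)\<^sup>2"
      by simp
    also have "\<dots> \<le> (real n / log 2 (real n)) powr (1/2 - \<alpha>) / 32 * (2 * real n powr (1/3))\<^sup>2"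
      using batch_size_le l(3) by (intro mult_mono power_mono) auto
    also note elim(3)
    finally show ?case
      using conic_batch_code[OF l(1) n k] by (intro exI[of _ "n + batch_size \<alpha> n * (2 ^ l)\<^sup>2"]) simp
  qed
qed

lemma repeated_code_redundancy:
  assumes \<epsilon>: "1/2 \<le> \<epsilon>"
  shows "redundancy_bigo (\<lambda>n. nat \<lfloor>real n powr \<epsilon>\<rfloor>) (\<lambda>n. real n powr (1/2 + \<epsilon>) * log 2 (real n))"
proof (rule redundancy_bigoI)
  have "\<forall>\<^sub>F n in at_top. 1 < real n"
    by real_asymp
  moreover have "\<forall>\<^sub>F n in at_top. log 2 (real n powr (1/4)) + 1 \<le> log 2 (real n)"
    by real_asymp
  ultimately show "\<forall>\<^sub>F n in at_top. \<exists>N\<ge>n. has_batch_code N n (nat \<lfloor>real n powr \<epsilon>\<rfloor>) \<and>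
      real N - real n \<le> 48 * real (card (simplex 4 5)) * (real n powr (1/2 + \<epsilon>) * log 2 (real n))"
  proof eventually_elim
    case (elim n)
    define x where "x = real n powr (1/4)"
    define w where "w = real n powr (\<epsilon> - 1/2)"
    have x: "1 < x" "x ^ 4 = real n" "x\<^sup>2 = real n powr (1/2)"
      using elim(1) by (simp_all add: x_def powr_power gr_one_powr)
    have "real (nat \<lfloor>real n powr \<epsilon>\<rfloor>) \<le> w * x\<^sup>2"
      unfolding x(3) w_def powr_add[symmetric] by (simp add: of_nat_floor)
    moreover have "1 \<le> w"
      unfolding w_def using elim(1) \<epsilon> by (intro ge_one_powr_ge_zero) auto
    ultimately obtain N where N: "n \<le> N" "has_batch_code N n (nat \<lfloor>real n powr \<epsilon>\<rfloor>)"
      "real N \<le> 48 * real (card (simplex 4 5)) * (w * real n * log 2 (real n))"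
      using repeated_code_of_scales[OF x(1,2), of "log 2 (real n)"] elim(2) unfolding x_def by blast
    have "w * real n = real n powr (\<epsilon> - 1/2) * real n powr 1"
      using elim(1) by (simp add: w_def)
    also have "\<dots> = real n powr (1/2 + \<epsilon>)"
      by (subst powr_add[symmetric]) (simp add: add.commute)
    finally show ?case
      using N by (intro exI[of _ N]) simp
  qed
qed

section \<open>The trade-off between batch size and redundancy\<close>

lemma batch_size_redundancy:
  assumes "0 < \<alpha>" "\<alpha> < 1/2"
  shows "redundancy_bigo (batch_size \<alpha>) (\<lambda>n. real n powr (1 - \<alpha>/3) * log 2 (real n) powr (\<alpha>/3))"
  using multiplicity_code_redundancy conic_code_redundancy assms by (cases "\<alpha> < 1/3") auto

theorem batch_size_redundancy_tradeoff:
  assumes "0 < \<alpha>" "\<alpha> < 1/2"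
  shows "\<exists>kf Nf :: nat \<Rightarrow> nat. (\<forall>\<^sub>F n in at_top. has_batch_code (Nf n) n (kf n)) \<and>
    (\<lambda>n. real (kf n)) \<in> \<Theta>(\<lambda>n. (real n / log 2 (real n)) powr (1/2 - \<alpha>)) \<and>
    (\<lambda>n. real (Nf n) - real n) \<in> O(\<lambda>n. real n powr (1 - \<alpha>/3) * log 2 (real n) powr (\<alpha>/3))"
proof -
  obtain Nf where Nf: "\<forall>\<^sub>F n in at_top. has_batch_code (Nf n) n (batch_size \<alpha> n)"
    "(\<lambda>n. real (Nf n) - real n) \<in> O(\<lambda>n. real n powr (1 - \<alpha>/3) * log 2 (real n) powr (\<alpha>/3))"
    using batch_size_redundancy[OF assms] unfolding redundancy_bigo_def by blast
  show ?thesis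
    by (rule exI[of _ "batch_size \<alpha>"], rule exI[of _ Nf]) (intro conjI Nf batch_size_bigtheta assms)
qed

theorem almost_polynomial_batch_codes:
  assumes \<epsilon>: "0 < \<epsilon>" "\<epsilon> < 1/2"
  shows "\<exists>kf Nf :: nat \<Rightarrow> nat. (\<forall>\<^sub>F n in at_top. has_batch_code (Nf n) n (kf n)) \<and>
    (\<forall>\<tau>>0. (\<lambda>n. real (kf n)) \<in> \<Omega>(\<lambda>n. real n powr (\<epsilon> - \<tau>))) \<and>
    (\<forall>\<tau>>0. (\<lambda>n. real (Nf n) - real n) \<in> O(\<lambda>n. real n powr (5/6 + \<epsilon>/3 + \<tau>)))"
proof -
  define \<alpha> where "\<alpha> = 1/2 - \<epsilon>"
  have \<alpha>: "0 < \<alpha>" "\<alpha> < 1/2" and exponent_eqs: "1 - \<alpha>/3 = 5/6 + \<epsilon>/3" "1/2 - \<alpha> = \<epsilon>"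
    using \<epsilon> by (auto simp: \<alpha>_def field_simps)
  obtain Nf where Nf: "\<forall>\<^sub>F n in at_top. has_batch_code (Nf n) n (batch_size \<alpha> n)"
    "(\<lambda>n. real (Nf n) - real n) \<in> O(\<lambda>n. real n powr (5/6 + \<epsilon>/3) * log 2 (real n) powr (\<alpha>/3))"
    using batch_size_redundancy[OF \<alpha>] unfolding redundancy_bigo_def exponent_eqs by blast
  have size: "(\<lambda>n. real (batch_size \<alpha> n)) \<in> \<Omega>(\<lambda>n. real n powr (\<epsilon> - \<tau>))" if "\<tau> > 0" for \<tau>
    unfolding batch_size_def exponent_eqs using \<epsilon> that by real_asymp
  have redundancy: "(\<lambda>n. real (Nf n) - real n) \<in> O(\<lambda>n. real n powr (5/6 + \<epsilon>/3 + \<tau>))" if "\<tau> > 0" for \<tau>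
  proof -
    note Nf(2)
    also have "(\<lambda>n. real n powr (5/6 + \<epsilon>/3) * log 2 (real n) powr (\<alpha>/3)) \<in> O(\<lambda>n. real n powr (5/6 + \<epsilon>/3 + \<tau>))"
      using \<alpha> that by real_asymp
    finally show ?thesis .
  qed
  show ?thesis
    by (rule exI[of _ "batch_size \<alpha>"], rule exI[of _ Nf]) (intro conjI allI impI Nf(1) size redundancy)
qed

theorem sublinear_redundancy_batch_codes:
  assumes \<epsilon>: "0 < \<epsilon>" "\<epsilon> < 1/2"
  shows "\<exists>kf Nf :: nat \<Rightarrow> nat. (\<forall>\<^sub>F n in at_top. has_batch_code (Nf n) n (kf n)) \<and>
    (\<lambda>n. real (kf n)) \<in> \<Theta>(\<lambda>n. real n powr \<epsilon>) \<and> (\<lambda>n. real (Nf n) - real n) \<in> o(\<lambda>n. real n)"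
proof -
  define \<alpha> where "\<alpha> = (1/2 - \<epsilon>) / 2"
  have \<alpha>: "0 < \<alpha>" "\<alpha> < 1/2" and \<epsilon>_less: "\<epsilon> < 1/2 - \<alpha>"
    using \<epsilon> by (auto simp: \<alpha>_def field_simps)
  have "\<forall>\<^sub>F n in at_top. real n powr \<epsilon> \<le> (real n / log 2 (real n)) powr (1/2 - \<alpha>) / 32"
    using \<epsilon>_less \<epsilon>(1) by real_asymp
  then have "\<forall>\<^sub>F n in at_top. nat \<lfloor>real n powr \<epsilon>\<rfloor> \<le> batch_size \<alpha> n"
    unfolding batch_size_def by eventually_elim (intro nat_mono floor_mono)
  then have "redundancy_bigo (\<lambda>n. nat \<lfloor>real n powr \<epsilon>\<rfloor>)
      (\<lambda>n. real n powr (1 - \<alpha>/3) * log 2 (real n) powr (\<alpha>/3))"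
    by (rule redundancy_bigo_mono[OF batch_size_redundancy[OF \<alpha>]])
  then obtain Nf where Nf: "\<forall>\<^sub>F n in at_top. has_batch_code (Nf n) n (nat \<lfloor>real n powr \<epsilon>\<rfloor>)"
    "(\<lambda>n. real (Nf n) - real n) \<in> O(\<lambda>n. real n powr (1 - \<alpha>/3) * log 2 (real n) powr (\<alpha>/3))"
    unfolding redundancy_bigo_def by blast
  note Nf(2)
  also have "(\<lambda>n. real n powr (1 - \<alpha>/3) * log 2 (real n) powr (\<alpha>/3)) \<in> o(\<lambda>n. real n)"
    using \<alpha> by real_asymp
  finally have redundancy: "(\<lambda>n. real (Nf n) - real n) \<in> o(\<lambda>n. real n)" .
  have size: "(\<lambda>n. real (nat \<lfloor>real n powr \<epsilon>\<rfloor>)) \<in> \<Theta>(\<lambda>n. real n powr \<epsilon>)"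
    using \<epsilon> by real_asymp
  show ?thesis
    by (rule exI[of _ "\<lambda>n. nat \<lfloor>real n powr \<epsilon>\<rfloor>"], rule exI[of _ Nf]) (intro conjI Nf(1) size redundancy)
qed

theorem large_batch_codes:
  assumes \<epsilon>: "1/2 \<le> \<epsilon>"
  shows "\<exists>kf Nf :: nat \<Rightarrow> nat. (\<forall>\<^sub>F n in at_top. has_batch_code (Nf n) n (kf n)) \<and>
    (\<lambda>n. real (kf n)) \<in> \<Theta>(\<lambda>n. real n powr \<epsilon>) \<and>
    (\<forall>\<tau>>0. (\<lambda>n. real (Nf n)) \<in> O(\<lambda>n. real n powr (1/2 + \<epsilon> + \<tau>)))"
proof -
  obtain Nf where Nf: "\<forall>\<^sub>F n in at_top. has_batch_code (Nf n) n (nat \<lfloor>real n powr \<epsilon>\<rfloor>)"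
    "(\<lambda>n. real (Nf n) - real n) \<in> O(\<lambda>n. real n powr (1/2 + \<epsilon>) * log 2 (real n))"
    using repeated_code_redundancy[OF \<epsilon>] unfolding redundancy_bigo_def by blast
  have length: "(\<lambda>n. real (Nf n)) \<in> O(\<lambda>n. real n powr (1/2 + \<epsilon> + \<tau>))" if "\<tau> > 0" for \<tau>
  proof -
    have "(\<lambda>n. real n powr (1/2 + \<epsilon>) * log 2 (real n)) \<in> O(\<lambda>n. real n powr (1/2 + \<epsilon> + \<tau>))"
      using that by real_asymp
    from landau_o.big_trans[OF Nf(2) this]
    have "(\<lambda>n. (real (Nf n) - real n) + real n) \<in> O(\<lambda>n. real n powr (1/2 + \<epsilon> + \<tau>))"
    proof (rule sum_in_bigo)
      show "(\<lambda>n. real n) \<in> O(\<lambda>n. real n powr (1/2 + \<epsilon> + \<tau>))"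
        using \<epsilon> that by real_asymp
    qed
    then show ?thesis
      by simp
  qed
  have size: "(\<lambda>n. real (nat \<lfloor>real n powr \<epsilon>\<rfloor>)) \<in> \<Theta>(\<lambda>n. real n powr \<epsilon>)"
    using \<epsilon> by real_asymp
  show ?thesis
    by (rule exI[of _ "\<lambda>n. nat \<lfloor>real n powr \<epsilon>\<rfloor>"], rule exI[of _ Nf]) (intro conjI allI impI Nf(1) size length)
qed

theorem theorem7:
  shows
  "(\<forall>\<alpha>::real. 0 < \<alpha> \<and> \<alpha> < 1/2 \<longrightarrow>
      (\<exists>kf Nf :: nat \<Rightarrow> nat.
         (\<forall>\<^sub>F n in at_top. has_batch_code (Nf n) n (kf n)) \<and>
         (\<lambda>n. real (kf n)) \<in> \<Theta>(\<lambda>n. (real n / log 2 (real n)) powr (1/2 - \<alpha>)) \<and>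
         (\<lambda>n. real (Nf n) - real n) \<in>
            O(\<lambda>n. real n powr (1 - \<alpha>/3) * (log 2 (real n)) powr (\<alpha>/3))))
   \<and>
   (\<forall>\<epsilon>::real. 0 < \<epsilon> \<and> \<epsilon> < 1/2 \<longrightarrow>
      (\<exists>kf Nf :: nat \<Rightarrow> nat.
         (\<forall>\<^sub>F n in at_top. has_batch_code (Nf n) n (kf n)) \<and>
         (\<forall>\<tau>>0. (\<lambda>n. real (kf n)) \<in> \<Omega>(\<lambda>n. real n powr (\<epsilon> - \<tau>))) \<and>
         (\<forall>\<tau>>0. (\<lambda>n. real (Nf n) - real n) \<in> O(\<lambda>n. real n powr (5/6 + \<epsilon>/3 + \<tau>))))
      \<and>
      (\<exists>kf Nf :: nat \<Rightarrow> nat.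
         (\<forall>\<^sub>F n in at_top. has_batch_code (Nf n) n (kf n)) \<and>
         (\<lambda>n. real (kf n)) \<in> \<Theta>(\<lambda>n. real n powr \<epsilon>) \<and>
         (\<lambda>n. real (Nf n) - real n) \<in> o(\<lambda>n. real n)))
   \<and>
   (\<forall>\<epsilon>::real. \<epsilon> \<ge> 1/2 \<longrightarrow>
      (\<exists>kf Nf :: nat \<Rightarrow> nat.
         (\<forall>\<^sub>F n in at_top. has_batch_code (Nf n) n (kf n)) \<and>
         (\<lambda>n. real (kf n)) \<in> \<Theta>(\<lambda>n. real n powr \<epsilon>) \<and>
         (\<forall>\<tau>>0. (\<lambda>n. real (Nf n)) \<in> O(\<lambda>n. real n powr (1/2 + \<epsilon> + \<tau>)))))"
  by (intro conjI allI impI batch_size_redundancy_tradeoff almost_polynomial_batch_codes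
      sublinear_redundancy_batch_codes large_batch_codes) auto

end
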